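(* Let $G$ be a 2-connected graph on $n$ vertices with vertex set $V(G)=\{x_i : 1\leq i\leq n\}$, and let $c$ be a positive integer with $c\leq n$. Suppose that for every pair of vertices $x_i,x_j$ with $i<j$, at least one of the following holds: (i) $i+j<c$; (ii) $x_ix_j\in E(G)$; (iii) $d(x_i)>i$; (iv) $d(x_j)\geq j$; (v) $d(x_i)+d(x_j)\geq c$. If $n\geq 3c-1$, then $c(G)\geq c$.
   Context: All graphs are simple and finite. A 2-connected graph has at least 3 vertices, is connected, and has no cut-vertex. $d(v)$ denotes the degree of $v$ in $G$. The circumference $c(G)$ is the length (number of edges) of a longest cycle in $G$; it should not be confused with the integer $c$. *)

theory Defs
  imports "Graph_Theory.Graph_Theory"
begin

text \<open>
  Simple finite graphs are the \<^locale>\<open>graph\<close>s of the library: finite, loop-free symmetric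
  digraphs without parallel arcs, in which an edge \<open>uv\<close> is the pair of arcs from \<open>u\<close> to \<open>v\<close>
  and from \<open>v\<close> to \<open>u\<close>.
\<close>

text \<open>Every edge at \<open>v\<close> contributes exactly one arc leaving \<open>v\<close>.\<close>

abbreviation vdegree :: "('a, 'b) pre_digraph \<Rightarrow> 'a \<Rightarrow> nat" where
  "vdegree G v \<equiv> out_degree G v"

text \<open>A cut-vertex separates two other vertices lying in the same component.\<close>

definition cut_vertex :: "('a, 'b) pre_digraph \<Rightarrow> 'a \<Rightarrow> bool" where
  "cut_vertex G v \<longleftrightarrow> v \<in> verts G \<and>
     (\<exists>u \<in> verts G - {v}. \<exists>w \<in> verts G - {v}.
        u \<rightarrow>\<^sup>*\<^bsub>G\<^esub> w \<and> \<not> u \<rightarrow>\<^sup>*\<^bsub>pre_digraph.del_vert G v\<^esub> w)"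

definition two_connected :: "('a, 'b) pre_digraph \<Rightarrow> bool" where
  "two_connected G \<longleftrightarrow>
     3 \<le> card (verts G) \<and> Digraph_Component.connected G \<and> \<not> (\<exists>v. cut_vertex G v)"

text \<open>
  The library's notion of cycle also admits, in a symmetric digraph, the closed walk that
  traverses a single edge back and forth; the bound 3 on the length excludes exactly these
  (loops being absent).
\<close>

definition graph_cycle :: "('a, 'b) pre_digraph \<Rightarrow> 'b list \<Rightarrow> bool" where
  "graph_cycle G p \<longleftrightarrow> pre_digraph.cycle G p \<and> 3 \<le> length p"

text \<open>
  The supremum is over a finite set of naturals, hence a maximum, except that it is 0 when
  there is no cycle.
\<close>

definition circumference :: "('a, 'b) pre_digraph \<Rightarrow> nat" where
  "circumference G = Sup {length p |p. graph_cycle G p}"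

end

(* The ends of a longest path, chosen with maximal sum of indices, both satisfy d(x_k) <= k; call
   such vertices exposed. By the cycle lemma (a path with ends u, v yields a cycle through all of
   its vertices or one of length at least d(u) + d(v), degrees counted on the path) this settles
   everything except ends whose indices sum to less than c.

   For the remaining case let t be the least degree of an exposed vertex, call a vertex low if its
   degree is less than c - t, and let X be the set of the other vertices. An exposed vertex of
   degree t shows that there are at most c - 1 low vertices. Among the paths with as many vertices
   of X as possible, and among these as many vertices as possible, take Q with maximal sum of end
   indices. No cycle contains all X-vertices of Q, the ends of Q are low and have degrees d, d' at
   least t, and predecessors of neighbours of one end and successors of neighbours of the other
   are disjoint sets of low vertices. On any path between two X-vertices with the maximal number of
   X-vertices, the neighbours of the ends off the path are distinct low vertices, so the cycle
   lemma allows at most d + d' - 3 low vertices on it. Such a path with d + d' - 2 low vertices is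
   obtained from Q: cut Q down to the part U between its first and last X-vertex, and reroute U
   through the two cut-off pieces, which are attached to U as detours from its first and last
   vertex. Rerouting gives up only the runs of low vertices next to the two attachment points, and
   these runs contain, up to one vertex each, none of the predecessors and successors counted
   above. *)

theory Submission
  imports Defs
begin

section \<open>Paths and cycles\<close>

text \<open>The obstacle is alternative (i): for two path ends with small indices it holds and
  yields nothing about their degrees. Looking instead at paths between two vertices of
  \<open>X\<close> pays because \<open>2 * t < c\<close>: their ends have degree sum at least 2(c -
  t), more than c, so the cycle lemma can fail to give a long cycle only if many neighbours of the
  ends lie off the path. On a path with as many vertices of \<open>X\<close> as possible those
  neighbours are low, and they compete with the low vertices on the path for the few low vertices
  that exist. This turns the problem into producing one such path that itself consumes enough low
  vertices. The size of n enters through \<open>card X\<close>: having at most c - 1 low vertices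
  leaves at least c vertices in \<open>X\<close>, so a cycle shorter than c misses one of them, and
  opening it towards that vertex gains a vertex of \<open>X\<close>. Hence no such cycle can compete
  with an extremal path. The count is tight. When both ends of the extremal path have degree exactly
  t, the bound c - 1 on the low vertices is one too large, and common neighbours of the two ends
  save the missing unit.\<close>

locale sgraph =
  fixes V :: "'a set" and E :: "'a \<Rightarrow> 'a \<Rightarrow> bool"
  assumes finV: "finite V"
    and E_sym: "E u v \<Longrightarrow> E v u"
    and E_irrefl: "\<not> E u u"
    and E_V: "E u v \<Longrightarrow> u \<in> V"
begin

lemma E_commute: "E u v \<longleftrightarrow> E v u"
  using E_sym by blast

lemma E_V2: "E u v \<Longrightarrow> v \<in> V"
  using E_sym E_V by blast

definition nbrs :: "'a \<Rightarrow> 'a set" where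
  "nbrs v = {u. E v u}"

definition deg :: "'a \<Rightarrow> nat" where
  "deg v = card (nbrs v)"

lemma nbrs_V: "nbrs v \<subseteq> V"
  by (auto simp: nbrs_def E_V2)

lemma fin_nbrs: "finite (nbrs v)"
  using nbrs_V finV finite_subset by blast

definition pth :: "'a list \<Rightarrow> bool" where
  "pth p \<longleftrightarrow> distinct p \<and> successively E p \<and> set p \<subseteq> V"

definition cyc :: "'a list \<Rightarrow> bool" where
  "cyc p \<longleftrightarrow> pth p \<and> 3 \<le> length p \<and> E (last p) (hd p)"

lemma pth_Nil [simp]: "pth []"
  by (simp add: pth_def)

lemma pth_append:
  "pth (p @ q) \<longleftrightarrow> pth p \<and> pth q \<and> set p \<inter> set q = {} \<and>
     (p = [] \<or> q = [] \<or> E (last p) (hd q))"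
  by (auto simp: pth_def successively_append_iff)

lemma pth_Cons:
  "pth (v # p) \<longleftrightarrow> v \<in> V \<and> v \<notin> set p \<and> pth p \<and> (p = [] \<or> E v (hd p))"
  by (cases p) (auto simp: pth_def)

lemma pth_rev [simp]: "pth (rev p) \<longleftrightarrow> pth p"
proof -
  have "(\<lambda>x y. E y x) = E"
    using E_commute by (intro ext) blast
  then have "successively E (rev p) = successively E p" by (simp only: successively_rev)
  then show ?thesis by (simp add: pth_def)
qed

lemma pth_single [simp]: "pth [v] \<longleftrightarrow> v \<in> V"
  by (simp add: pth_def)

lemma pth_card: "pth p \<Longrightarrow> card (set p) = length p"
  by (simp add: pth_def distinct_card)

lemma pth_nth: "pth p \<Longrightarrow> Suc i < length p \<Longrightarrow> E (p ! i) (p ! Suc i)"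
  by (simp add: pth_def successively_conv_nth)

text \<open>A shortest walk inside \<open>S\<close> from anywhere in \<open>Y\<close> to anywhere in
  \<open>T\<close> works: a repeated vertex, a later visit to \<open>Y\<close> or an earlier visit
  to \<open>T\<close> would each allow a shortcut. If \<open>Y\<close> and \<open>T\<close> meet,
  \<open>F\<close> may be a single vertex.\<close>

lemma fan_path:
  assumes reach: "(\<lambda>a b. E a b \<and> a \<in> S \<and> b \<in> S)\<^sup>*\<^sup>* u w"
    and "u \<in> Y" "w \<in> T" "u \<in> S" "S \<subseteq> V"
  obtains F where "F \<noteq> []" "pth F" "set F \<subseteq> S" "hd F \<in> Y" "last F \<in> T"
    "set F \<inter> Y = {hd F}" "set F \<inter> T = {last F}"
proof -
  define W where "W F \<longleftrightarrow> F \<noteq> [] \<and> successively E F \<and> set F \<subseteq> S \<and> hd F \<in> Y \<and> last F \<in> T" for F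
  have "\<exists>F. F \<noteq> [] \<and> successively E F \<and> set F \<subseteq> S \<and> hd F = u \<and> last F = w"
    using reach
  proof (induction rule: rtranclp_induct)
    case base
    then show ?case using assms(4) by (intro exI[of _ "[u]"]) simp
  next
    case (step y z)
    then obtain F where "F \<noteq> []" "successively E F" "set F \<subseteq> S" "hd F = u" "last F = y" by blast
    with step.hyps show ?case
      by (intro exI[of _ "F @ [z]"]) (auto simp: successively_append_iff)
  qed
  then have "\<exists>F. W F" using assms by (auto simp: W_def)
  then obtain F where F: "W F" and min: "\<And>F'. W F' \<Longrightarrow> length F \<le> length F'"
    using ex_has_least_nat[of W _ length] by blast
  have dist: "distinct F"
  proof (rule ccontr)
    assume "\<not> distinct F"
    then obtain xs ys zs y where F_eq: "F = xs @ [y] @ ys @ [y] @ zs"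
      using not_distinct_decomp by blast
    have "W (xs @ [y] @ zs)"
      using F unfolding W_def F_eq
      by (auto simp: successively_append_iff successively_Cons hd_append split: if_splits)
    from min[OF this] show False by (simp add: F_eq)
  qed
  have oneY: "y = hd F" if yF: "y \<in> set F" and yY: "y \<in> Y" for y
  proof -
    obtain xs ys where F_eq: "F = xs @ y # ys" using split_list[OF yF] by blast
    have "W (y # ys)" using F yY unfolding W_def F_eq
      by (auto simp: successively_append_iff)
    from min[OF this] show ?thesis by (simp add: F_eq)
  qed
  have oneT: "y = last F" if yF: "y \<in> set F" and yY: "y \<in> T" for y
  proof -
    obtain xs ys where F_eq: "F = xs @ y # ys" using split_list[OF yF] by blast
    have "W (xs @ [y])" using F yY unfolding W_def F_eq
      by (auto simp: successively_append_iff successively_Cons hd_append split: if_splits)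
    from min[OF this] show ?thesis by (simp add: F_eq)
  qed
  show thesis
  proof (rule that[of F])
    show "F \<noteq> []" "set F \<subseteq> S" "hd F \<in> Y" "last F \<in> T" using F by (auto simp: W_def)
    show "pth F" using F dist assms(5) by (auto simp: W_def pth_def)
    show "set F \<inter> Y = {hd F}" using oneY F by (auto simp: W_def)
    show "set F \<inter> T = {last F}" using oneT F by (auto simp: W_def)
  qed
qed

end

text \<open>Absence of cut-vertices is expressed as connectedness of \<open>V - {z}\<close> for
  every \<open>z\<close>, with both ends of each step confined to that set, which is the shape that
  \<open>fan_path\<close> consumes.\<close>

locale two_conn = sgraph +
  assumes V3: "3 \<le> card V"
    and conn: "u \<in> V \<Longrightarrow> w \<in> V \<Longrightarrow> (\<lambda>a b. E a b \<and> a \<in> V \<and> b \<in> V)\<^sup>*\<^sup>* u w"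
    and conn_del: "u \<in> V - {z} \<Longrightarrow> w \<in> V - {z} \<Longrightarrow>
      (\<lambda>a b. E a b \<and> a \<in> V - {z} \<and> b \<in> V - {z})\<^sup>*\<^sup>* u w"
begin

lemma fan_conn:
  assumes "Y \<inter> V \<noteq> {}" "T \<inter> V \<noteq> {}"
  obtains F where "F \<noteq> []" "pth F" "hd F \<in> Y" "last F \<in> T"
    "set F \<inter> Y = {hd F}" "set F \<inter> T = {last F}"
proof -
  obtain u w where uw: "u \<in> Y \<inter> V" "w \<in> T \<inter> V" using assms by blast
  show thesis
    by (rule fan_path[OF conn[of u w], of Y T]) (use uw that in auto)
qed

lemma fan_del:
  assumes "Y \<inter> (V - {z}) \<noteq> {}" "T \<inter> (V - {z}) \<noteq> {}"
  obtains F where "F \<noteq> []" "pth F" "z \<notin> set F" "hd F \<in> Y" "last F \<in> T"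
    "set F \<inter> Y = {hd F}" "set F \<inter> T = {last F}"
proof -
  obtain u w where uw: "u \<in> Y \<inter> (V - {z})" "w \<in> T \<inter> (V - {z})" using assms by blast
  show thesis
    by (rule fan_path[OF conn_del[of u z w], of Y T]) (use uw that in auto)
qed

text \<open>A sole neighbour \<open>y\<close> of \<open>v\<close> would separate \<open>v\<close>
  from a third vertex: a path avoiding \<open>y\<close> could not take its first step. If
  \<open>v\<close> has no neighbour at all, any other vertex serves as \<open>y\<close>.\<close>

lemma deg_ge2:
  assumes v: "v \<in> V"
  shows "2 \<le> deg v"
proof (rule ccontr)
  assume "\<not> 2 \<le> deg v"
  then have "card (nbrs v) \<le> 1" by (simp add: deg_def)
  then obtain y where y: "nbrs v \<subseteq> {y}" "y \<noteq> v"
  proof (cases "nbrs v = {}")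
    case True
    have "\<not> V \<subseteq> {v}" using V3 card_mono[of "{v}" V] by auto
    then show thesis using True that by blast
  next
    case False
    with \<open>card (nbrs v) \<le> 1\<close> fin_nbrs have "card (nbrs v) = 1"
      by (metis card_0_eq le_neq_implies_less less_one)
    then obtain y where "nbrs v = {y}" using card_1_singletonE by blast
    then show thesis using that[of y] E_irrefl by (auto simp: nbrs_def)
  qed
  have "\<not> V \<subseteq> {v, y}" using V3 card_mono[of "{v, y}" V] card_insert_le_m1[of 2 "{y}" v] by auto
  then have *: "{v} \<inter> (V - {y}) \<noteq> {}" "(V - {v, y}) \<inter> (V - {y}) \<noteq> {}" using v y by auto
  obtain F where F: "F \<noteq> []" "pth F" "y \<notin> set F" "hd F \<in> {v}" "last F \<in> V - {v, y}"
    using fan_del[OF *] by metis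
  then obtain w F' where "F = v # w # F'"
    by (metis DiffD2 insertCI last_ConsL list.collapse singletonD)
  then show False using F y by (auto simp: pth_Cons nbrs_def)
qed

end

section \<open>Two disjoint paths\<close>

context two_conn
begin

text \<open>\<open>P\<close> is the part of \<open>W\<close> strictly before the branching vertex
  \<open>hd F\<close>. It therefore misses \<open>last W\<close>, and this is what frees that vertex
  for the other path in \<open>link_step\<close>.\<close>

lemma splice:
  assumes "pth W" "pth F" "F \<noteq> []" "set F \<inter> set W = {hd F}"
  obtains P where "pth (P @ F)" "hd (P @ F) = hd W" "set P \<subseteq> set W - {hd F, last W}"
proof -
  obtain P P2 where W: "W = P @ hd F # P2" using assms(4) split_list[of "hd F" W] by blast
  have "hd F \<notin> set P" "set P \<inter> set P2 = {}" using assms(1) by (auto simp: W pth_def)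
  then have sub: "set P \<subseteq> set W - {hd F, last W}" by (auto simp: W)
  have "set P \<inter> set F = {}"
  proof -
    have "set P \<inter> set F \<subseteq> {hd F}" using assms(4) W by auto
    then show ?thesis using \<open>hd F \<notin> set P\<close> by auto
  qed
  then have "pth (P @ F)" using assms(1,2) by (auto simp: W pth_append)
  moreover have "hd (P @ F) = hd W" by (cases P) (auto simp: W)
  ultimately show thesis using sub that by blast
qed

text \<open>A linkage of order two in the sense of Menger. Since the paths are disjoint, the last
  two clauses say that each of them meets \<open>J\<close> only in its head and \<open>K\<close>
  only in its last vertex.\<close>

definition link :: "'a set \<Rightarrow> 'a set \<Rightarrow> 'a list \<Rightarrow> 'a list \<Rightarrow> bool" where
  "link J K A B \<longleftrightarrow> A \<noteq> [] \<and> B \<noteq> [] \<and> pth A \<and> pth B \<and> set A \<inter> set B = {} \<and>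
    hd A \<in> J \<and> hd B \<in> J \<and> last A \<in> K \<and> last B \<in> K \<and>
    (\<forall>x \<in> set A \<union> set B. x \<in> J \<longrightarrow> x = hd A \<or> x = hd B) \<and>
    (\<forall>x \<in> set A \<union> set B. x \<in> K \<longrightarrow> x = last A \<or> x = last B)"

text \<open>An augmentation step that removes one vertex from the target set. If \<open>r\<close> is
  not on \<open>B\<close>, then \<open>A\<close> is prolonged by \<open>r\<close>. Otherwise
  \<open>B\<close> already ends in \<open>r\<close>, and a path \<open>F\<close> to \<open>T\<close>
  that avoids \<open>r\<close> provides the second end; what happens depends on where
  \<open>F\<close> leaves \<open>A\<close>, \<open>B\<close> or \<open>J\<close>. The head
  \<open>h\<close> is tracked because \<open>two_paths\<close> must not lose it.\<close>

lemma link_step: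
  assumes AB: "link J (insert (last A) (insert r T)) A B" and h: "hd A = h \<or> hd B = h"
    and r: "last A \<notin> insert r T" "r \<notin> T" "r \<in> V" "E (last A) r"
    and J: "J \<inter> insert r T = {}" and T: "T \<subseteq> V" "T \<noteq> {}"
  shows "\<exists>A' B'. link J (insert r T) A' B' \<and> (hd A' = h \<or> hd B' = h) \<and> last A' = r"
proof -
  note l = AB[unfolded link_def]
  have lB: "last B \<in> insert r T" using l by (metis disjoint_iff insertE last_in_set)
  have AK: "x \<notin> insert r T" if "x \<in> set A" for x
    using that l r(1) by (metis Un_iff disjoint_iff insertCI last_in_set)
  have BK: "x = last B" if "x \<in> set B" "x \<in> insert r T" for x
    using that l r(1) by (metis Un_iff insertCI)
  show ?thesis
  proof (cases "r \<in> set B")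
    case False
    have "link J (insert r T) (A @ [r]) B"
    proof -
      have "pth (A @ [r])" using l r AK by (auto simp: pth_append)
      moreover have "x = r \<or> x = last B" if "x \<in> set (A @ [r]) \<union> set B" "x \<in> insert r T" for x
        using that AK BK by auto
      moreover have "x = hd A \<or> x = hd B" if "x \<in> set (A @ [r]) \<union> set B" "x \<in> J" for x
      proof -
        have "x \<in> set A \<union> set B" using that J by auto
        then show ?thesis using that l by blast
      qed
      ultimately show ?thesis unfolding link_def using l lB False by simp
    qed
    then show ?thesis using h l by (intro exI[of _ "A @ [r]"] exI[of _ B]) auto
  next
    case True
    then have lBr: "last B = r" using BK by simp
    define Y where "Y = set A \<union> set B \<union> J"
    have hA: "hd A \<in> Y" "hd A \<in> V" "hd A \<noteq> r"
      using l AK by (auto simp: Y_def pth_def)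
    then have *: "Y \<inter> (V - {r}) \<noteq> {}" "T \<inter> (V - {r}) \<noteq> {}" using T r(2) by blast+
    obtain F where F: "F \<noteq> []" "pth F" "r \<notin> set F" "hd F \<in> Y" "last F \<in> T"
      "set F \<inter> Y = {hd F}" "set F \<inter> T = {last F}"
      using fan_del[OF *] by metis
    have KF: "x \<in> set F \<longleftrightarrow> x = last F" if "x \<in> insert r T" for x
      using that F(3,5,7) F(1) by (metis Int_iff insertE singletonD singletonI)
    have KF2: "last F \<in> insert r T" using F(5) by simp
    have FA: "set F \<inter> (set A \<union> set B \<union> J) = {hd F}" using F(6) by (simp add: Y_def)
    consider (a) "hd F \<in> set A" | (b) "hd F \<in> set B" | (c) "hd F \<notin> set A \<union> set B" "hd F \<in> J"
      using F(4) by (auto simp: Y_def)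
    then show ?thesis
    proof cases
      case a
      have nb: "set F \<inter> set A = {hd F}" using FA a by auto
      obtain P where P: "pth (P @ F)" "hd (P @ F) = hd A" "set P \<subseteq> set A - {hd F, last A}"
        using splice[of A F] l F nb by blast
      have hF': "x = hd F" if "x \<in> set F" "x \<in> set A \<union> set B \<union> J" for x
        using FA that by blast
      have "set F \<inter> set B = {}" using hF' a l by (metis UnI1 UnI2 disjoint_iff)
      then have dis: "set B \<inter> set (P @ F) = {}" using P(3) l by auto
      have "x = hd B \<or> x = hd A" if "x \<in> set B \<union> set (P @ F)" "x \<in> J" for x
      proof -
        have "x \<in> set A \<union> set B" using that P(3) hF' a by auto
        then show ?thesis using that l by blast
      qed
      moreover have "x = last B \<or> x = last F" if "x \<in> set B \<union> set (P @ F)" "x \<in> insert r T" for x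
      proof (cases "x \<in> set F")
        case True
        then show ?thesis using KF that by simp
      next
        case False
        then show ?thesis using that P(3) BK AK by auto
      qed
      ultimately have "link J (insert r T) B (P @ F)"
        unfolding link_def using l P dis F(1) KF2 lB by simp
      then show ?thesis using h P(2) lBr by blast
    next
      case b
      have nb: "set F \<inter> set B = {hd F}" using FA b by auto
      obtain P where P: "pth (P @ F)" "hd (P @ F) = hd B" "set P \<subseteq> set B - {hd F, last B}"
        using splice[of B F] l F nb by blast
      have hF': "x = hd F" if "x \<in> set F" "x \<in> set A \<union> set B \<union> J" for x
        using FA that by blast
      have FA0: "set F \<inter> set A = {}" using hF' b l by (metis UnI1 disjoint_iff)
      have rP: "r \<notin> set (P @ F)" using P(3) lBr F(3) by auto
      have dis: "set (A @ [r]) \<inter> set (P @ F) = {}" using P(3) l FA0 rP by auto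
      have "x = hd A \<or> x = hd B" if "x \<in> set (A @ [r]) \<union> set (P @ F)" "x \<in> J" for x
      proof -
        have "x \<in> set A \<union> set B" using that P(3) hF' b J by auto
        then show ?thesis using that l by blast
      qed
      moreover have "x = r \<or> x = last F" if "x \<in> set (A @ [r]) \<union> set (P @ F)" "x \<in> insert r T" for x
      proof (cases "x \<in> set F")
        case True
        then show ?thesis using KF that by simp
      next
        case False
        then show ?thesis using that P(3) BK AK lBr by auto
      qed
      moreover have "pth (A @ [r])" using l r AK by (auto simp: pth_append)
      ultimately have "link J (insert r T) (A @ [r]) (P @ F)"
        unfolding link_def using l P dis F(1) KF2 by simp
      moreover have "hd (A @ [r]) = h \<or> hd (P @ F) = h" using h P(2) l by simp
      ultimately show ?thesis by (metis last_snoc)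
    next
      \<comment> \<open>\<open>F\<close> starts at a vertex of \<open>J\<close> on neither path. A
        path starting in \<open>h\<close> is kept and the other one is replaced by \<open>F\<close>;
        a kept \<open>A\<close> is prolonged by \<open>r\<close>, a kept \<open>B\<close> ends there
        already.\<close>
      case c
      have hF': "x = hd F" if "x \<in> set F" "x \<in> set A \<union> set B \<union> J" for x
        using FA that by blast
      have FA0: "set F \<inter> set A = {}" "set F \<inter> set B = {}" using hF' c(1) by blast+
      show ?thesis
      proof (cases "hd A = h")
        case True
        have dis: "set (A @ [r]) \<inter> set F = {}" using FA0 F(3) by auto
        have "x = hd A \<or> x = hd F" if "x \<in> set (A @ [r]) \<union> set F" "x \<in> J" for x
        proof (cases "x \<in> set F")
          case True
          then show ?thesis using hF' that by blast
        next
          case False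
          then have "x \<in> set A" using that J by auto
          then have "x = hd A \<or> x = hd B" "x \<notin> set B" using that l by blast+
          then show ?thesis using l by (metis hd_in_set)
        qed
        moreover have "x = r \<or> x = last F" if "x \<in> set (A @ [r]) \<union> set F" "x \<in> insert r T" for x
          using that KF AK by auto
        moreover have "pth (A @ [r])" using l r AK by (auto simp: pth_append)
        ultimately have "link J (insert r T) (A @ [r]) F"
          unfolding link_def using l dis F(1,2) KF2 c by simp
        then show ?thesis using True l by (intro exI[of _ "A @ [r]"] exI[of _ F]) auto
      next
        case False
        then have hB: "hd B = h" using h by simp
        have "x = hd B \<or> x = hd F" if "x \<in> set B \<union> set F" "x \<in> J" for x
        proof (cases "x \<in> set F")
          case True
          then show ?thesis using hF' that by blast
        next
          case False
          then have "x \<in> set B" using that by auto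
          then have "x = hd A \<or> x = hd B" "x \<notin> set A" using that l by blast+
          then show ?thesis using l by (metis hd_in_set)
        qed
        moreover have "x = last B \<or> x = last F" if "x \<in> set B \<union> set F" "x \<in> insert r T" for x
          using that KF BK by auto
        ultimately have "link J (insert r T) B F"
          unfolding link_def using l FA0 F(1,2) KF2 lB c by (simp add: Int_commute)
        then show ?thesis using hB lBr by blast
      qed
    qed
  qed
qed

text \<open>Menger's theorem alone would not guarantee that \<open>R ! j\<close> and
  \<open>R ! k\<close> are among the ends of the two paths. Moving the start of the target along
  \<open>R\<close> one vertex at a time keeps the head \<open>R ! j\<close> and makes each new
  target vertex an end.\<close>

lemma two_paths:
  assumes R: "pth R" and "1 \<le> j" "j \<le> k" "Suc k < length R"
  shows "\<exists>A B. link (set (take (Suc j) R)) (set (drop k R)) A B \<and>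
    (hd A = R ! j \<or> hd B = R ! j) \<and> last A = R ! k"
  using assms(3,4)
proof (induction k rule: dec_induct)
  case base
  have dR: "distinct R" "set R \<subseteq> V" using R by (auto simp: pth_def)
  have tk: "take (Suc j) R = take j R @ [R ! j]" using base by (simp add: take_Suc_conv_app_nth)
  have dr: "drop j R = R ! j # drop (Suc j) R" using base by (simp add: Cons_nth_drop_Suc)
  define P where "P = set (take j R)"
  define T where "T = set (drop (Suc j) R)"
  have PT: "set (take (Suc j) R) = insert (R ! j) P" "set (drop j R) = insert (R ! j) T"
    by (auto simp: tk dr P_def T_def)
  have "distinct (take j R @ R ! j # drop (Suc j) R)"
    using dR(1) base by (simp flip: id_take_nth_drop)
  then have dis: "R ! j \<notin> P" "R ! j \<notin> T" "P \<inter> T = {}" by (auto simp: P_def T_def)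
  have inV: "P \<subseteq> V" "T \<subseteq> V" "R ! j \<in> V"
    using dR(2) base by (auto simp: P_def T_def dest: in_set_takeD in_set_dropD)
  have ne: "P \<noteq> {}" "T \<noteq> {}" using base assms(2) by (auto simp: P_def T_def)
  have *: "P \<inter> (V - {R ! j}) \<noteq> {}" "T \<inter> (V - {R ! j}) \<noteq> {}"
    using inV dis ne by blast+
  obtain F where F: "F \<noteq> []" "pth F" "R ! j \<notin> set F" "hd F \<in> P"
    "last F \<in> T" "set F \<inter> P = {hd F}" "set F \<inter> T = {last F}"
    using fan_del[OF *] by metis
  have "link (insert (R ! j) P) (insert (R ! j) T) [R ! j] F"
    unfolding link_def using F inV dis by auto
  then show ?case unfolding PT by (intro exI[of _ "[R ! j]"] exI[of _ F]) simp
next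
  case (step k)
  define J where "J = set (take (Suc j) R)"
  define r where "r = R ! Suc k"
  define T where "T = set (drop (Suc (Suc k)) R)"
  have dR: "distinct R" "set R \<subseteq> V" using R by (auto simp: pth_def)
  have dk: "drop k R = R ! k # r # drop (Suc (Suc k)) R"
    using step.prems by (simp add: Cons_nth_drop_Suc r_def)
  have dk1: "drop (Suc k) R = r # drop (Suc (Suc k)) R"
    using step.prems by (simp add: Cons_nth_drop_Suc r_def)
  have sdk: "set (drop k R) = insert (R ! k) (insert r T)" "set (drop (Suc k) R) = insert r T"
    by (auto simp: dk dk1 T_def)
  have "distinct (drop k R)" using dR by simp
  then have rT: "R ! k \<notin> insert r T" "r \<notin> T" by (auto simp: dk T_def)
  have rV: "r \<in> V" "T \<subseteq> V" "T \<noteq> {}"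
    using dR step.prems by (auto simp: r_def T_def dest: in_set_dropD)
  have JT: "J \<inter> insert r T = {}"
    using set_take_disj_set_drop_if_distinct[OF dR(1), of "Suc j" "Suc k"] step.hyps sdk(2)
    by (simp add: J_def)
  have Er: "E (R ! k) r" using pth_nth[OF R, of k] step.prems by (simp add: r_def)
  obtain A B where AB: "link J (insert (R ! k) (insert r T)) A B"
    "hd A = R ! j \<or> hd B = R ! j" "last A = R ! k"
    using step.IH step.prems unfolding sdk J_def by auto
  show ?case
    unfolding sdk J_def[symmetric] r_def[symmetric]
    by (rule link_step) (use AB rT rV JT Er in auto)
qed

end

section \<open>The cycle lemma\<close>

context two_conn
begin

lemma card_nth_idx:
  assumes "distinct R"
  shows "card {i. i < length R \<and> P (R ! i)} = card {y \<in> set R. P y}"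
proof (rule bij_betw_same_card[of "(!) R"])
  show "bij_betw ((!) R) {i. i < length R \<and> P (R ! i)} {y \<in> set R. P y}"
    using assms by (auto simp: bij_betw_def inj_on_def nth_eq_iff_index_eq in_set_conv_nth)
qed

text \<open>Walk back from \<open>R ! j\<close> to the first neighbour \<open>R ! q\<close> of
  \<open>R ! 0\<close> after position \<open>i\<close>, jump to \<open>R ! 0\<close>, and walk up to
  \<open>R ! i\<close>. Only positions strictly between \<open>i\<close> and \<open>q\<close> are
  skipped, and these carry no neighbour of \<open>R ! 0\<close>. So all its neighbours on
  \<open>R\<close> are visited, and \<open>R ! 0\<close> itself accounts for the
  \<open>+ 1\<close>.\<close>

lemma arc:
  assumes R: "pth R" and j: "j < length R" "E (R ! 0) (R ! j)" and ij: "i < j"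
    and mx: "\<And>s. s < length R \<Longrightarrow> E (R ! 0) (R ! s) \<Longrightarrow> s \<le> j"
  obtains T where "pth T" "T \<noteq> []" "hd T = R ! j" "last T = R ! i"
    "set T \<subseteq> set (take (Suc j) R)"
    "card {s. s < length R \<and> E (R ! 0) (R ! s)} + 1 \<le> length T"
proof -
  define S where "S = {s. s < length R \<and> E (R ! 0) (R ! s)}"
  define q where "q = Min {s \<in> S. i < s}"
  have fin: "finite S" by (simp add: S_def)
  have "j \<in> {s \<in> S. i < s}" using j ij by (simp add: S_def)
  then have "q \<in> {s \<in> S. i < s}" "q \<le> j" unfolding q_def
    using fin by (intro Min_in Min_le; force)+
  then have q: "q \<in> S" "i < q" "q \<le> j" by auto
  have qmin: "\<And>s. s \<in> S \<Longrightarrow> i < s \<Longrightarrow> q \<le> s" using fin by (simp add: q_def)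
  define M where "M = drop q (take (Suc j) R)"
  have tk: "take (Suc j) R = take q R @ M"
    using q by (metis M_def append_take_drop_id le_SucI min.absorb1 take_take)
  have tq: "take q R = take (Suc i) R @ drop (Suc i) (take q R)"
    using q by (metis Suc_leI append_take_drop_id min.absorb1 take_take)
  have lenM: "length M = Suc j - q" using j by (simp add: M_def)
  then have M: "M \<noteq> []" using q by auto
  have hdM: "hd M = R ! q" using q j by (simp add: M_def hd_drop_conv_nth)
  have lastM: "last M = R ! j" using q j M by (simp add: M_def last_drop last_conv_nth)
  have tis: "take (Suc i) R = take i R @ [R ! i]" using j ij by (simp add: take_Suc_conv_app_nth)
  have Rne: "R \<noteq> []" using j(1) by auto
  then have ti: "take (Suc i) R \<noteq> []" "hd (take (Suc i) R) = R ! 0" "last (take (Suc i) R) = R ! i"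
    "length (take (Suc i) R) = Suc i"
    using j(1) ij by (simp_all add: hd_conv_nth tis[symmetric]) (simp add: tis)
  have "pth (take (Suc j) R @ drop (Suc j) R)" using R by simp
  then have ptk: "pth (take (Suc j) R)" unfolding pth_append by blast
  then have p1: "pth M" "pth (take q R)" "set (take q R) \<inter> set M = {}"
    unfolding tk pth_append by auto
  have p2: "pth (take (Suc i) R)" "set (take (Suc i) R) \<subseteq> set (take q R)"
    using p1(2) by (subst (asm) tq, simp add: pth_append, subst tq, simp)
  have Sq: "E (R ! q) (R ! 0)" using q E_sym by (auto simp: S_def)
  have "S \<subseteq> {1..i} \<union> {q..j}"
  proof
    fix s assume s: "s \<in> S"
    then have "s \<noteq> 0" using E_irrefl by (cases s) (auto simp: S_def)
    moreover have "s \<le> j" using s mx by (auto simp: S_def)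
    ultimately show "s \<in> {1..i} \<union> {q..j}" using qmin[OF s] by (cases "i < s") auto
  qed
  then have "card S \<le> card ({1..i} \<union> {q..j})" by (rule card_mono[rotated]) simp
  also have "\<dots> \<le> card {1..i} + card {q..j}" by (rule card_Un_le)
  finally have cS: "card S \<le> i + (Suc j - q)" by simp
  show thesis
  proof (rule that[of "rev M @ take (Suc i) R"])
    show "pth (rev M @ take (Suc i) R)"
      using p1 p2 Sq M ti hdM by (auto simp: pth_append last_rev)
    show "rev M @ take (Suc i) R \<noteq> []" using M by simp
    show "hd (rev M @ take (Suc i) R) = R ! j" using M lastM by (simp add: hd_rev)
    show "last (rev M @ take (Suc i) R) = R ! i" by (simp add: tis)
    show "set (rev M @ take (Suc i) R) \<subseteq> set (take (Suc j) R)" using p2(2) tk by auto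
    show "card {s. s < length R \<and> E (R ! 0) (R ! s)} + 1 \<le> length (rev M @ take (Suc i) R)"
      using cS ti lenM by (simp flip: S_def)
  qed
qed

text \<open>With \<open>j\<close> the last neighbour position of \<open>R ! 0\<close>, the heads of
  the two paths from \<open>two_paths\<close> are joined by the path from \<open>arc\<close>. That
  path contributes one more than the number of neighbours; the second path has a vertex after its
  head, because it ends beyond position \<open>k\<close> while its head is at most at
  \<open>j\<close>. Together this is the \<open>+ 2\<close>.\<close>

lemma ear:
  assumes R: "pth R" and k: "Suc k < length R"
    and mx: "\<And>s. s < length R \<Longrightarrow> E (R ! 0) (R ! s) \<Longrightarrow> s \<le> k"
    and ex: "s0 < length R" "E (R ! 0) (R ! s0)"
  obtains F where "pth F" "F \<noteq> []" "hd F = R ! k" "last F \<in> set (drop (Suc k) R)"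
    "set F \<inter> set (drop k R) = {hd F, last F}"
    "card {s. s < length R \<and> E (R ! 0) (R ! s)} + 2 \<le> length F"
proof -
  define S where "S = {s. s < length R \<and> E (R ! 0) (R ! s)}"
  define j where "j = Max S"
  have fin: "finite S" by (simp add: S_def)
  have "s0 \<in> S" using ex by (simp add: S_def)
  then have jS: "j \<in> S" unfolding j_def using fin by (intro Max_in) auto
  have jmax: "\<And>s. s \<in> S \<Longrightarrow> s \<le> j" using fin by (simp add: j_def)
  have j: "j < length R" "E (R ! 0) (R ! j)" "j \<le> k" using jS mx by (auto simp: S_def)
  have "j \<noteq> 0" using j(2) E_irrefl by (cases j) auto
  then have "1 \<le> j" by simp
  from two_paths[OF R this j(3) k] obtain A B where
    "link (set (take (Suc j) R)) (set (drop k R)) A B"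
    and AB0: "hd A = R ! j \<or> hd B = R ! j" "last A = R ! k"
    by blast
  note l = this(1)[unfolded link_def]
  then have AB: "A \<noteq> []" "B \<noteq> []" "pth A" "pth B" "set A \<inter> set B = {}" by auto
  have ABJ: "x = hd A \<or> x = hd B" if "x \<in> set A \<union> set B" "x \<in> set (take (Suc j) R)" for x
    using l that by blast
  have ABK: "x = last A \<or> x = last B" if "x \<in> set A \<union> set B" "x \<in> set (drop k R)" for x
    using l that by blast
  have dR: "distinct R" using R by (simp add: pth_def)
  have hAB: "hd A \<in> set (take (Suc j) R)" "hd B \<in> set (take (Suc j) R)" using l by auto
  have hABne: "hd A \<noteq> hd B" using AB(1,2,5) by (metis disjoint_iff hd_in_set)
  have idx: "\<exists>i<j. y = R ! i" if "y \<in> set (take (Suc j) R)" "y \<noteq> R ! j" for y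
    using that j by (auto simp: in_set_conv_nth less_Suc_eq)
  obtain T where T: "pth T" "T \<noteq> []" "hd T = hd A" "last T = hd B"
    "set T \<subseteq> set (take (Suc j) R)" "card S + 1 \<le> length T"
  proof (cases "hd A = R ! j")
    case True
    then obtain i where i: "i < j" "hd B = R ! i" using idx hAB hABne by metis
    have mxj: "\<And>s. s < length R \<Longrightarrow> E (R ! 0) (R ! s) \<Longrightarrow> s \<le> j" using jmax by (simp add: S_def)
    obtain T where T: "pth T" "T \<noteq> []" "hd T = R ! j" "last T = R ! i"
      "set T \<subseteq> set (take (Suc j) R)" "card S + 1 \<le> length T"
      using arc[OF R j(1,2) i(1) mxj] unfolding S_def by blast
    show thesis
      by (rule that[of T]) (use T i True in auto)
  next
    case False
    then obtain i where i: "i < j" "hd A = R ! i" using idx hAB hABne by metis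
    have hB: "hd B = R ! j" using False AB0 by simp
    have mxj: "\<And>s. s < length R \<Longrightarrow> E (R ! 0) (R ! s) \<Longrightarrow> s \<le> j" using jmax by (simp add: S_def)
    obtain T where T: "pth T" "T \<noteq> []" "hd T = R ! j" "last T = R ! i"
      "set T \<subseteq> set (take (Suc j) R)" "card S + 1 \<le> length T"
      using arc[OF R j(1,2) i(1) mxj] unfolding S_def by blast
    show thesis
      by (rule that[of "rev T"]) (use T i hB in \<open>auto simp: hd_rev last_rev\<close>)
  qed
  obtain A' where A: "A = hd A # A'" using AB(1) by (cases A) auto
  obtain B' where B: "B = hd B # B'" using AB(2) by (cases B) auto
  have "take (Suc j) R = take (Suc j) (take (Suc k) R)" using j by (simp add: min_def)
  then have tjk: "set (take (Suc j) R) \<subseteq> set (take (Suc k) R)"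
    by (metis set_take_subset)
  have d1: "set (take (Suc k) R) \<inter> set (drop (Suc k) R) = {}"
    using set_take_disj_set_drop_if_distinct[OF dR, of "Suc k" "Suc k"] by simp
  have dk: "set (drop k R) = insert (R ! k) (set (drop (Suc k) R))"
    using k by (metis Cons_nth_drop_Suc Suc_lessD list.simps(15))
  have "last A \<noteq> last B" using AB by (metis disjoint_iff last_in_set)
  then have lBk: "last B \<in> set (drop (Suc k) R)" using l AB0(2) dk by auto
  have B'ne: "B' \<noteq> []"
  proof
    assume "B' = []"
    then have "last B = hd B" using B by (metis last_ConsL)
    then show False using lBk hAB(2) tjk d1 by auto
  qed
  have "pth (hd A # A')" "pth (hd B # B')" using AB(3,4) A B by simp_all
  then have A': "hd A \<notin> set A'" "pth A'" "A' \<noteq> [] \<Longrightarrow> E (hd A) (hd A')"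
    and B': "hd B \<notin> set B'" "pth B'" "E (hd B) (hd B')"
    using B'ne by (auto simp: pth_Cons)
  have sub: "set A' \<subseteq> set A" "set B' \<subseteq> set B" using A B set_subset_Cons by metis+
  have lB': "last B' = last B" using B B'ne by (metis last_ConsR)
  define F where "F = rev A' @ T @ B'"
  have hdF: "hd F = R ! k"
  proof (cases "A' = []")
    case True
    then have "last A = hd A" using A by (metis last_ConsL)
    then show ?thesis using True T AB0(2) by (simp add: F_def)
  next
    case False
    then have "last A' = last A" using A by (metis last_ConsR)
    then show ?thesis using False AB0(2) by (simp add: F_def hd_rev)
  qed
  have lastF: "last F = last B" using B'ne lB' by (simp add: F_def)
  have TA1: "set A' \<inter> set T = {}"
  proof -
    have False if "x \<in> set A'" "x \<in> set T" for x
    proof -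
      have "x \<in> set A" "x \<in> set (take (Suc j) R)" using that T(5) sub(1) by auto
      then have "x = hd A \<or> x = hd B" "x \<notin> set B" using ABJ AB(5) by blast+
      then show False using A'(1) that AB(2) by auto
    qed
    then show ?thesis by blast
  qed
  have TA2: "set B' \<inter> set T = {}"
  proof -
    have False if "x \<in> set B'" "x \<in> set T" for x
    proof -
      have "x \<in> set B" "x \<in> set (take (Suc j) R)" using that T(5) sub(2) by auto
      then have "x = hd A \<or> x = hd B" "x \<notin> set A" using ABJ AB(5) by blast+
      then show False using B'(1) that AB(1) by auto
    qed
    then show ?thesis by blast
  qed
  note TA = TA1 TA2
  have pF: "pth F"
  proof -
    have "A' = [] \<or> E (hd A') (hd A)" using A'(3) E_sym by blast
    moreover have "set A' \<inter> set B' = {}" using sub AB(5) by blast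
    ultimately show ?thesis
      unfolding F_def pth_append using A'(2) B'(2,3) T(1-4) TA B'ne
      by (simp add: last_rev Int_Un_distrib Int_commute)
  qed
  have TK: "x = R ! k" if "x \<in> set T" "x \<in> set (drop k R)" for x
    using that T(5) tjk d1 dk by auto
  have "x = hd F \<or> x = last F" if "x \<in> set F" "x \<in> set (drop k R)" for x
  proof (cases "x \<in> set T")
    case True
    then show ?thesis using TK that hdF by simp
  next
    case False
    then have "x \<in> set A \<union> set B" using that sub by (auto simp: F_def)
    then show ?thesis using ABK that hdF lastF AB0(2) by simp
  qed
  moreover have "F \<noteq> []" using T(2) by (simp add: F_def)
  then have "hd F \<in> set F" "last F \<in> set F" by auto
  ultimately have "set F \<inter> set (drop k R) = {hd F, last F}"
    using hdF lastF dk lBk by auto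
  moreover have "card S + 2 \<le> length F"
    using T(6) B'ne by (cases B') (auto simp: F_def)
  ultimately show thesis
    using that[of F] pF hdF lastF lBk \<open>F \<noteq> []\<close> by (simp add: S_def)
qed

text \<open>If some neighbour of the last vertex comes before some neighbour of the first, a closest
  pair of this kind closes a cycle that skips only the gap between them. If no two neighbours cross
  like this, \<open>ear\<close> from one side and \<open>arc\<close> from the other share their ends
  and form the cycle.\<close>

lemma cycle_lemma:
  assumes R: "pth R" and len: "3 \<le> length R"
  shows "\<exists>C. cyc C \<and> (set R \<subseteq> set C \<or>
    card (nbrs (hd R) \<inter> set R) + card (nbrs (last R) \<inter> set R) \<le> length C)"
proof -
  define m where "m = length R"
  define S where "S = {s. s < length R \<and> E (R ! 0) (R ! s)}"
  define S' where "S' = {s. s < length R \<and> E (R ! (m - 1)) (R ! s)}"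
  have m: "3 \<le> m" using len by (simp add: m_def)
  have dR: "distinct R" using R by (simp add: pth_def)
  have hl: "hd R = R ! 0" "last R = R ! (m - 1)"
    using m by (cases R, auto simp: m_def last_conv_nth)+
  have cS: "card (nbrs (hd R) \<inter> set R) = card S"
    unfolding S_def card_nth_idx[OF dR] hl by (rule arg_cong[of _ _ card]) (auto simp: nbrs_def)
  have cS': "card (nbrs (last R) \<inter> set R) = card S'"
    unfolding S'_def card_nth_idx[OF dR] hl by (rule arg_cong[of _ _ card]) (auto simp: nbrs_def)
  have fin: "finite S" "finite S'" by (auto simp: S_def S'_def)
  show ?thesis
  proof (cases "E (R ! 0) (R ! (m - 1))")
    case True
    then have "cyc R" using R len hl E_sym by (auto simp: cyc_def)
    then show ?thesis by blast
  next
    case nadj: False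
    have S1: "1 \<in> S" using pth_nth[OF R, of 0] m by (auto simp: S_def m_def)
    have "Suc (m - 2) < length R" "Suc (m - 2) = m - 1" using m by (auto simp: m_def)
    with pth_nth[OF R, of "m - 2"] have S'1: "m - 2 \<in> S'"
      using E_sym m by (auto simp: S'_def m_def)
    have Sb: "1 \<le> s \<and> s \<le> m - 2" if "s \<in> S" for s
    proof -
      have "s \<noteq> 0" "s \<noteq> m - 1" using that E_irrefl nadj by (auto simp: S_def intro: gr0I)
      then show ?thesis using that by (auto simp: S_def m_def)
    qed
    have S'b: "1 \<le> s \<and> s \<le> m - 2" if "s \<in> S'" for s
    proof -
      have "s \<noteq> 0" "s \<noteq> m - 1" using that E_irrefl nadj E_sym by (auto simp: S'_def intro: gr0I)
      then show ?thesis using that by (auto simp: S'_def m_def)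
    qed
    show ?thesis
    proof (cases "\<exists>s\<in>S. \<exists>s'\<in>S'. s' < s")
      case True
      \<comment> \<open>A crossing pair with minimal gap: no neighbour of either end of
        \<open>R\<close> lies strictly inside the gap.\<close>
      define D where "D d \<longleftrightarrow> (\<exists>s\<in>S. \<exists>s'\<in>S'. s' < s \<and> d = s - s')" for d
      have "\<exists>d. D d" using True unfolding D_def by blast
      then have "D (LEAST d. D d)" by (rule LeastI_ex)
      then obtain s s' where s: "s \<in> S" "s' \<in> S'" "s' < s" "(LEAST d. D d) = s - s'"
        unfolding D_def by blast
      have mn: "s - s' \<le> k - k'" if "k \<in> S" "k' \<in> S'" "k' < k" for k k'
        using s(4) Least_le[of D "k - k'"] that unfolding D_def by auto
      define C where "C = take (Suc s') R @ rev (drop s R)"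
      have sb: "1 \<le> s" "s \<le> m - 2" "1 \<le> s'" using Sb S'b s by auto
      have ls: "length C = Suc s' + (m - s)" using s sb by (simp add: C_def m_def)
      have l3: "3 \<le> length C" using ls sb m s(3) by linarith
      have ne: "take (Suc s') R \<noteq> []" "drop s R \<noteq> []" using sb m by (auto simp: m_def)
      have hh: "hd (take (Suc s') R) = R ! 0" "last (take (Suc s') R) = R ! s'"
        "hd (drop s R) = R ! s" "last (drop s R) = R ! (m - 1)"
        using sb m s(3) ne by (auto simp: hd_conv_nth last_conv_nth m_def hd_drop_conv_nth)
      have "pth (take (Suc s') R @ drop (Suc s') R)" "pth (take s R @ drop s R)" using R by auto
      then have pp: "pth (take (Suc s') R)" "pth (drop s R)" unfolding pth_append by auto
      have dis: "set (take (Suc s') R) \<inter> set (drop s R) = {}"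
        using set_take_disj_set_drop_if_distinct[OF dR, of "Suc s'" s] s(3) by auto
      have "pth C"
        unfolding C_def pth_append using pp dis ne hh s(2) E_sym
        by (auto simp: hd_rev S'_def)
      moreover have "E (last C) (hd C)"
        using ne hh s(1) E_sym by (auto simp: C_def last_rev S_def)
      ultimately have cyc: "cyc C" using l3 by (simp add: cyc_def)
      show ?thesis
      proof (cases "s = Suc s'")
        case True
        have "set R = set (take s R) \<union> set (drop s R)" by (metis append_take_drop_id set_append)
        then have "set R \<subseteq> set C" by (auto simp: C_def True)
        then show ?thesis using cyc by blast
      next
        case False
        \<comment> \<open>The gap now has inner vertices. By minimality the positions just before
          neighbours of the first vertex are not neighbours of the last one, so the two sets can be
          counted together. After the shift they fit into intervals of the same total size as the
          positions \<open>{0..s'}\<close> and \<open>{s..m - 1}\<close> kept by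
          \<open>C\<close>.\<close>
        define S1 where "S1 = (\<lambda>k. k - 1) ` S"
        have "inj_on (\<lambda>k. k - 1) S" using Sb by (intro inj_onI) (metis One_nat_def Suc_pred' less_eq_Suc_le)
        then have c1: "card S1 = card S" by (simp add: S1_def card_image)
        have dis: "S1 \<inter> S' = {}"
        proof -
          have False if "k \<in> S" "k - 1 \<in> S'" for k
            using mn[OF that] Sb[OF that(1)] s(3) False by auto
          then show ?thesis by (auto simp: S1_def)
        qed
        have "S1 \<union> S' \<subseteq> {0..s'} \<union> {s - 1..m - 2}"
        proof
          fix y assume "y \<in> S1 \<union> S'"
          then consider (1) k where "k \<in> S" "y = k - 1" | (2) "y \<in> S'" by (auto simp: S1_def)
          then show "y \<in> {0..s'} \<union> {s - 1..m - 2}"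
          proof cases
            case 1
            have "s \<le> k \<or> k \<le> s'" using mn[OF 1(1) s(2)] s(3) by linarith
            then show ?thesis using Sb[OF 1(1)] 1(2) by auto
          next
            case 2
            have "s \<le> y \<or> y \<le> s'" using mn[OF s(1) 2] s(3) by linarith
            then show ?thesis using S'b[OF 2] by auto
          qed
        qed
        then have "card (S1 \<union> S') \<le> card ({0..s'} \<union> {s - 1..m - 2})" by (rule card_mono[rotated]) simp
        also have "\<dots> \<le> card {0..s'} + card {s - 1..m - 2}" by (rule card_Un_le)
        also have "\<dots> = length C" using ls sb s(3) m by simp
        finally have "card S + card S' \<le> length C"
          using dis c1 fin by (simp add: card_Un_disjoint S1_def)
        then show ?thesis using cyc cS cS' by auto
      qed
    next
      case False
      \<comment> \<open>No crossing: all neighbours of the first vertex sit at or before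
        \<open>k\<close>. The ear runs from \<open>R ! k\<close> to a later \<open>R ! l\<close>,
        touching \<open>drop k R\<close> only there; \<open>arc\<close> on the reversed path joins
        the same two vertices inside \<open>drop k R\<close>.\<close>
      define k where "k = Min S'"
      have k1: "k \<in> S'" unfolding k_def by (rule Min_in) (use S'1 fin in auto)
      have k2: "\<And>s. s \<in> S' \<Longrightarrow> k \<le> s" using fin(2) by (simp add: k_def)
      note k = k1 k2
      have kb: "Suc k < length R" "1 \<le> k" using S'b[OF k(1)] m by (auto simp: m_def)
      have "\<And>s. s < length R \<Longrightarrow> E (R ! 0) (R ! s) \<Longrightarrow> s \<le> k"
        using False k(1) by (force simp: S_def)
      from ear[OF R kb(1) this, of 1] S1 obtain F where
        F: "pth F" "F \<noteq> []" "hd F = R ! k" "last F \<in> set (drop (Suc k) R)"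
        "set F \<inter> set (drop k R) = {hd F, last F}" "card S + 2 \<le> length F"
        unfolding S_def by blast
      obtain l where l: "k < l" "l < m" "last F = R ! l"
      proof -
        obtain i where "i < length (drop (Suc k) R)" "last F = drop (Suc k) R ! i"
          using F(4) by (metis in_set_conv_nth)
        then show thesis using that[of "Suc k + i"] by (auto simp: m_def)
      qed
      have rn: "rev R ! i = R ! (m - 1 - i)" if "i < m" for i
        using that by (simp add: rev_nth m_def)
      have rn0: "rev R ! 0 = R ! (m - 1)" using rn[of 0] m by simp
      have eqS': "{s. s < length (rev R) \<and> E (rev R ! 0) (rev R ! s)} = (\<lambda>s. m - 1 - s) ` S'"
      proof (intro set_eqI iffI)
        fix s assume "s \<in> {s. s < length (rev R) \<and> E (rev R ! 0) (rev R ! s)}"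
        then have sm: "s < m" and e: "E (rev R ! 0) (rev R ! s)" by (auto simp: m_def)
        have "E (R ! (m - 1)) (R ! (m - 1 - s))" using e rn[OF sm] rn0 by simp
        then show "s \<in> (\<lambda>s. m - 1 - s) ` S'"
          using sm m by (intro image_eqI[of _ _ "m - 1 - s"]) (auto simp: S'_def m_def)
      next
        fix s assume "s \<in> (\<lambda>s. m - 1 - s) ` S'"
        then obtain u where u: "u \<in> S'" "s = m - 1 - u" by blast
        then have sm: "s < m" "m - 1 - s = u" using S'b[OF u(1)] m by auto
        have "E (rev R ! 0) (rev R ! s)" using u(1) sm rn[OF sm(1)] rn0 by (simp add: S'_def)
        then show "s \<in> {s. s < length (rev R) \<and> E (rev R ! 0) (rev R ! s)}"
          using sm by (simp add: m_def)
      qed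
      have inj: "inj_on (\<lambda>s. m - 1 - s) S'" by (rule inj_onI) (use S'b in fastforce)
      have mx: "s \<le> m - 1 - k" if "s < length (rev R)" "E (rev R ! 0) (rev R ! s)" for s
      proof -
        have "s \<in> (\<lambda>s. m - 1 - s) ` S'" using eqS' that by blast
        then obtain u where u: "u \<in> S'" "s = m - 1 - u" by blast
        show "s \<le> m - 1 - k" using k(2)[OF u(1)] u(2) by simp
      qed
      have km: "m - 1 - k < m" "m - 1 - (m - 1 - k) = k" using kb m by (auto simp: m_def)
      have b1: "m - 1 - k < length (rev R)" using km by (simp add: m_def)
      have b2: "m - 1 - l < m - 1 - k" using l by simp
      have b3: "E (rev R ! 0) (rev R ! (m - 1 - k))"
        using k(1) rn[OF km(1)] rn0 km(2) by (simp add: S'_def)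
      have pR: "pth (rev R)" using R by simp
      obtain T where T: "pth T" "T \<noteq> []" "hd T = rev R ! (m - 1 - k)"
        "last T = rev R ! (m - 1 - l)" "set T \<subseteq> set (take (Suc (m - 1 - k)) (rev R))"
        "card ((\<lambda>s. m - 1 - s) ` S') + 1 \<le> length T"
        using arc[OF pR b1 b3 b2 mx] unfolding eqS' by blast
      have T': "hd T = R ! k" "last T = R ! l" using T(3,4) rn l kb by (auto simp: m_def)
      have "take (Suc (m - 1 - k)) (rev R) = rev (drop k R)"
        using kb by (simp add: take_rev m_def)
      then have Tset: "set T \<subseteq> set (drop k R)" using T(5) by simp
      have cT: "card S' + 1 \<le> length T" using T(6) card_image[OF inj] by simp
      have "R ! k \<noteq> R ! l" using dR l kb by (auto simp: nth_eq_iff_index_eq m_def)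
      then obtain T1 where T1: "T = R ! k # T1 @ [R ! l]"
        using T' T(2) by (metis append_butlast_last_id hd_Cons_tl last_ConsL last_tl)
      define C where "C = F @ rev T1"
      have t: "pth T1" "R ! k \<notin> set T1" "R ! l \<notin> set T1" "E (R ! k) (hd (T1 @ [R ! l]))"
        "T1 \<noteq> [] \<Longrightarrow> E (last T1) (R ! l)"
        using T(1) by (auto simp: T1 pth_Cons pth_append)
      have "set F \<inter> set T1 = {}"
      proof -
        have False if x: "x \<in> set F" "x \<in> set T1" for x
        proof -
          have "x \<in> set F \<inter> set (drop k R)" using x Tset by (auto simp: T1)
          then have "x = R ! k \<or> x = R ! l" using F(3,5) l(3) by auto
          then show False using t(2,3) x(2) by blast
        qed
        then show ?thesis by blast
      qed
      then have "pth C"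
        using F t l(3) E_sym by (auto simp: C_def pth_append hd_rev)
      moreover have "E (last C) (hd C)"
        using F t l(3) E_sym by (cases "T1 = []") (auto simp: C_def last_rev)
      \<comment> \<open>At least \<open>card S + 2\<close> vertices from \<open>F\<close> and
        \<open>card S' + 1\<close> from \<open>T\<close>, less the two shared ends.\<close>
      moreover have lC: "card S + card S' + 1 \<le> length C" using cT F(6) by (simp add: C_def T1)
      moreover have "3 \<le> length C"
      proof -
        have "1 \<le> card S" "1 \<le> card S'"
          using S1 S'1 fin by (metis card_0_eq empty_iff less_one linorder_not_le)+
        then show ?thesis using lC by simp
      qed
      ultimately show ?thesis using cS cS' by (intro exI[of _ C]) (auto simp: cyc_def)
    qed
  qed
qed

end

section \<open>Detours\<close>

lemma prev_gap:
  fixes L :: "nat \<Rightarrow> bool"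
  assumes "\<not> L 0" "0 < z"
  obtains x where "x < z" "\<not> L x" "\<And>k. x < k \<Longrightarrow> k < z \<Longrightarrow> L k"
proof -
  define A where "A = {x. x < z \<and> \<not> L x}"
  have A: "finite A" "0 \<in> A" using assms by (auto simp: A_def)
  then have "Max A \<in> A" by (metis Max_in empty_iff)
  moreover have "L k" if "Max A < k" "k < z" for k
  proof (rule ccontr)
    assume "\<not> L k"
    then have "k \<in> A" using that by (simp add: A_def)
    from Max_ge[OF A(1) this] show False using that by simp
  qed
  moreover have "x < z \<and> \<not> L x" if "x \<in> A" for x using that by (simp add: A_def)
  ultimately show thesis using that[of "Max A"] by blast
qed

lemma next_gap:
  fixes L :: "nat \<Rightarrow> bool"
  assumes "\<not> L n" "z < n"
  obtains y where "z < y" "y \<le> n" "\<not> L y" "\<And>k. z < k \<Longrightarrow> k < y \<Longrightarrow> L k"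
proof -
  define y where "y = (LEAST y. z < y \<and> \<not> L y)"
  have "z < y \<and> \<not> L y" unfolding y_def by (rule LeastI[of _ n]) (use assms in simp)
  moreover have "y \<le> n" unfolding y_def by (rule Least_le) (use assms in simp)
  moreover have "L k" if "z < k" "k < y" for k
    using not_less_Least[of k "\<lambda>y. z < y \<and> \<not> L y"] that by (auto simp: y_def)
  ultimately show thesis using that[of y] by blast
qed

lemma card_four_disjoint:
  assumes "finite S" "A \<subseteq> S" "B \<subseteq> S" "C \<subseteq> S" "D \<subseteq> S"
    "A \<inter> B = {}" "A \<inter> C = {}" "A \<inter> D = {}" "B \<inter> C = {}" "B \<inter> D = {}" "C \<inter> D = {}"
  shows "card A + card B + card C + card D \<le> card S"
proof -
  have fin: "finite A" "finite B" "finite C" "finite D" using assms finite_subset by metis+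
  have "card (A \<union> (B \<union> (C \<union> D))) = card A + (card B + (card C + card D))"
    using fin assms by (simp add: card_Un_disjoint Int_Un_distrib)
  moreover have "card (A \<union> (B \<union> (C \<union> D))) \<le> card S"
    using assms by (intro card_mono) auto
  ultimately show ?thesis by simp
qed

text \<open>
  \<open>H\<close> and \<open>H'\<close> are the attachment positions on a path with \<open>m\<close> vertices of detours leaving from
  its first and its last vertex; \<open>L\<close> marks its low vertices.
\<close>

lemma gap_count:
  fixes L :: "nat \<Rightarrow> bool" and m :: nat and H H' :: "nat set"
  assumes L: "\<not> L 0" "\<not> L (m - 1)" and m: "0 < m"
    and H: "H \<subseteq> {1..<m - 1}" "H \<noteq> {}" and H': "H' \<subseteq> {1..<m - 1}" "H' \<noteq> {}"
    and cross: "\<And>k k'. k \<in> H \<Longrightarrow> k' \<in> H' \<Longrightarrow> k' < k \<Longrightarrow> \<exists>y. k' < y \<and> y < k \<and> \<not> L y"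
    and pH: "card H = 1 \<or> (\<forall>k\<in>H. L (k - 1))"
    and pH': "card H' = 1 \<or> (\<forall>k\<in>H'. L (Suc k))"
  defines "c \<equiv> card {i. i < m \<and> L i}"
  shows "(\<exists>z\<in>H. \<exists>z'\<in>H'. \<exists>x y. z \<le> z' \<and> x < z \<and> z' < y \<and> y < m \<and> \<not> L x \<and> \<not> L y \<and>
      (\<forall>k. x < k \<and> k < z \<longrightarrow> L k) \<and> (\<forall>k. z' < k \<and> k < y \<longrightarrow> L k) \<and>
      card H + card H' + (z - 1 - x) + (y - 1 - z') \<le> c + 2) \<or>
    (\<exists>z\<in>H. \<exists>z'\<in>H'. \<exists>x w. x < z' \<and> z' < w \<and> w < z \<and> \<not> L x \<and> \<not> L w \<and>
      (\<forall>k. x < k \<and> k < z' \<longrightarrow> L k) \<and> (\<forall>k. w < k \<and> k < z \<longrightarrow> L k) \<and>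
      card H + card H' + (z' - 1 - x) + (z - 1 - w) \<le> c + 2)"
proof -
  have fin: "finite H" "finite H'" using H H' finite_subset by blast+
  \<comment> \<open>One attachment position of each kind is reserved for the rerouting; only the
    predecessors or successors of the others are counted. These two reserved positions are the
    \<open>+ 2\<close> of the conclusion. If \<open>card H = 1\<close>, the set \<open>P z\<close>
    is empty for \<open>z\<close> in \<open>H\<close>, and nothing need be low.\<close>
  define P where "P z = (\<lambda>k. k - 1) ` (H - {z})" for z
  define P' where "P' z = Suc ` (H' - {z})" for z
  have cP: "card (P z) = card H - 1" if "z \<in> H" for z
  proof -
    have "inj_on (\<lambda>k. k - 1) (H - {z})"
    proof (rule inj_onI)
      fix a b assume "a \<in> H - {z}" "b \<in> H - {z}" and eq: "a - 1 = b - 1"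
      then have "1 \<le> a" "1 \<le> b" using H(1) by auto
      then show "a = b" using eq by simp
    qed
    then show ?thesis using that fin by (simp add: P_def card_image)
  qed
  have cP': "card (P' z) = card H' - 1" if "z \<in> H'" for z
    using that fin by (simp add: P'_def card_image)
  have cH: "1 \<le> card H" "1 \<le> card H'"
    using H(2) H'(2) fin by (simp_all add: Suc_le_eq card_gt_0_iff)
  have one: "k = z" if "card A = 1" "k \<in> A" "z \<in> A" for A and k z :: nat
    using that by (metis card_1_singletonE singletonD)
  have LP: "k \<ge> 1 \<and> L (k - 1)" if "z \<in> H" "k \<in> H" "k \<noteq> z" for k z
    using pH that one[of H k z] H(1) by auto
  have LP': "k < m - 1 \<and> L (Suc k)" if "z \<in> H'" "k \<in> H'" "k \<noteq> z" for k z
    using pH' that one[of H' k z] H'(1) by auto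
  have sub: "P z \<subseteq> {i. i < m \<and> L i}" if "z \<in> H" for z
  proof
    fix i assume "i \<in> P z"
    then obtain k where k: "k \<in> H" "k \<noteq> z" "i = k - 1" by (auto simp: P_def)
    have "k < m" using subsetD[OF H(1) k(1)] unfolding atLeastLessThan_iff by linarith
    then show "i \<in> {i. i < m \<and> L i}" using LP[OF that k(1,2)] k(3) by auto
  qed
  have sub': "P' z \<subseteq> {i. i < m \<and> L i}" if "z \<in> H'" for z
  proof
    fix i assume "i \<in> P' z"
    then obtain k where k: "k \<in> H'" "k \<noteq> z" "i = Suc k" by (auto simp: P'_def)
    then show "i \<in> {i. i < m \<and> L i}" using LP'[OF that k(1,2)] by auto
  qed
  \<comment> \<open>A common position \<open>k - 1 = Suc k'\<close> would be the only one between
    \<open>k'\<close> and \<open>k\<close>, and it is low, contrary to \<open>cross\<close>.\<close>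
  have PP': "P z \<inter> P' z' = {}" if "z \<in> H" for z z'
  proof -
    have False if k: "k \<in> H" "k \<noteq> z" "k' \<in> H'" "k - 1 = Suc k'" for k k'
    proof -
      have *: "k = Suc (Suc k')" "L (k - 1)" using LP[OF \<open>z \<in> H\<close> k(1,2)] k(4) by auto
      then obtain y where "k' < y" "y < k" "\<not> L y" using cross[of k k'] k by auto
      then have "y = k - 1" using * by simp
      then show False using * \<open>\<not> L y\<close> by simp
    qed
    then show ?thesis unfolding P_def P'_def by blast
  qed
  have count: "card H + card H' + card R + card R' \<le> c + 2"
    if "z \<in> H" "z' \<in> H'" "R \<subseteq> {i. i < m \<and> L i}" "R' \<subseteq> {i. i < m \<and> L i}"
      "P z \<inter> R = {}" "P z \<inter> R' = {}" "P' z' \<inter> R = {}" "P' z' \<inter> R' = {}" "R \<inter> R' = {}"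
    for z z' R R'
  proof -
    have "card (P z) + card (P' z') + card R + card R' \<le> c"
      unfolding c_def
      by (rule card_four_disjoint) (use that sub sub' PP' in auto)
    then show ?thesis using cP[OF that(1)] cP'[OF that(2)] cH by linarith
  qed
  show ?thesis
  proof (cases "\<exists>z\<in>H. \<exists>z'\<in>H'. z \<le> z'")
    case True
    then obtain z0 z0' where z0: "z0 \<in> H" "z0' \<in> H'" "z0 \<le> z0'" by blast
    have z0b: "0 < z0" "z0' < m - 1"
      using subsetD[OF H(1) z0(1)] subsetD[OF H'(1) z0(2)] unfolding atLeastLessThan_iff by linarith+
    obtain x where x: "x < z0" "\<not> L x" "\<And>k. x < k \<Longrightarrow> k < z0 \<Longrightarrow> L k"
      using prev_gap[of L z0] L z0b by metis
    obtain y where y: "z0' < y" "y \<le> m - 1" "\<not> L y" "\<And>k. z0' < k \<Longrightarrow> k < y \<Longrightarrow> L k"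
      using next_gap[of L "m - 1" z0'] L z0b by metis
    \<comment> \<open>The attachment is moved back to the first position of \<open>H\<close> after
      \<open>x\<close>. The other positions of \<open>H\<close> then have their predecessors outside
      the run between \<open>x\<close> and \<open>z\<close>. Dually, \<open>z'\<close> is moved
      forward to the last position of \<open>H'\<close> before \<open>y\<close>.\<close>
    define z where "z = Min {k \<in> H. x < k}"
    define z' where "z' = Max {k \<in> H'. k < y}"
    have "z \<in> {k \<in> H. x < k}" unfolding z_def by (rule Min_in) (use fin z0 x in auto)
    then have z: "z \<in> H" "x < z" by auto
    have zmin: "z \<le> k" if "k \<in> H" "x < k" for k
      unfolding z_def by (rule Min_le) (use fin that in auto)
    have "z' \<in> {k \<in> H'. k < y}" unfolding z'_def by (rule Max_in) (use fin z0 y in auto)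
    then have z': "z' \<in> H'" "z' < y" by auto
    have zmax: "k \<le> z'" if "k \<in> H'" "k < y" for k
      unfolding z'_def by (rule Max_ge) (use fin that in auto)
    have zz: "z \<le> z0" "z0' \<le> z'" using zmin zmax z0 x y by auto
    have Lx: "L k" if "x < k" "k < z" for k using x(3) that zz by auto
    have Ly: "L k" if "z' < k" "k < y" for k using y(4) that zz by auto
    have ym: "y < m" using y(2) m by simp
    have zm: "z < m" "z' < m"
      using subsetD[OF H(1) z(1)] subsetD[OF H'(1) z'(1)] unfolding atLeastLessThan_iff by linarith+
    have "card H + card H' + card {x<..<z} + card {z'<..<y} \<le> c + 2"
    proof (rule count[OF z(1) z'(1)])
      show "{x<..<z} \<subseteq> {i. i < m \<and> L i}" "{z'<..<y} \<subseteq> {i. i < m \<and> L i}"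
        using Lx Ly ym zm by auto
      show "P z \<inter> {x<..<z} = {}"
        using zmin unfolding P_def by fastforce
      show "P' z' \<inter> {z'<..<y} = {}"
        using zmax unfolding P'_def by fastforce
      show "{x<..<z} \<inter> {z'<..<y} = {}" using zz z0(3) by auto
      show "P z \<inter> {z'<..<y} = {}"
      proof -
        have False if k: "k \<in> H" "z' < k - 1" "k - 1 < y" for k
        proof -
          have "z' < k" using k by linarith
          then obtain q where "z' < q" "q < k" "\<not> L q" using cross[OF k(1) z'(1)] by blast
          then show False using Ly[of q] k by auto
        qed
        then show ?thesis unfolding P_def by fastforce
      qed
      show "P' z' \<inter> {x<..<z} = {}"
      proof -
        have False if k: "k \<in> H'" "x < Suc k" "Suc k < z" for k
        proof -
          obtain q where "k < q" "q < z" "\<not> L q" using cross[OF z(1) k(1)] k by auto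
          then show False using Lx[of q] k by auto
        qed
        then show ?thesis unfolding P'_def by fastforce
      qed
    qed
    then have "card H + card H' + (z - 1 - x) + (y - 1 - z') \<le> c + 2" by simp
    then show ?thesis using z z' x(2) y(3) ym zz z0(3) Lx Ly
      by (intro disjI1 bexI[of _ z] bexI[of _ z'] exI[of _ x] exI[of _ y]) auto
  next
    case False
    then have lt: "k' < k" if "k \<in> H" "k' \<in> H'" for k k' using that by (meson not_le)
    \<comment> \<open>Here all of \<open>H'\<close> precedes all of \<open>H\<close>. Both runs to
      be given up lie before their attachment positions; \<open>cross\<close> puts a non-low
      position between \<open>z'\<close> and \<open>z\<close>, so \<open>z' < w\<close> and the runs
      are disjoint.\<close>
    define z where "z = Min H"
    define z' where "z' = Min H'"
    have z: "z \<in> H" "z' \<in> H'" unfolding z_def z'_def using fin H(2) H'(2) by simp_all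
    have zmin: "\<And>k. k \<in> H \<Longrightarrow> z \<le> k" "\<And>k. k \<in> H' \<Longrightarrow> z' \<le> k"
      unfolding z_def z'_def using fin by simp_all
    have zb: "0 < z" "0 < z'" "z < m" "z' < m"
      using subsetD[OF H(1) z(1)] subsetD[OF H'(1) z(2)] unfolding atLeastLessThan_iff by linarith+
    obtain w where w: "w < z" "\<not> L w" "\<And>k. w < k \<Longrightarrow> k < z \<Longrightarrow> L k"
      using prev_gap[of L z] L zb by metis
    obtain x where x: "x < z'" "\<not> L x" "\<And>k. x < k \<Longrightarrow> k < z' \<Longrightarrow> L k"
      using prev_gap[of L z'] L zb by metis
    obtain q where q: "z' < q" "q < z" "\<not> L q" using cross[OF z lt[OF z]] by blast
    then have zw: "z' < w" using w(3)[of q] by force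
    have "card H + card H' + card {x<..<z'} + card {w<..<z} \<le> c + 2"
    proof (rule count[OF z])
      show "{x<..<z'} \<subseteq> {i. i < m \<and> L i}" "{w<..<z} \<subseteq> {i. i < m \<and> L i}"
        using x w zb by auto
      show "P z \<inter> {w<..<z} = {}" using zmin(1) unfolding P_def by fastforce
      show "P z \<inter> {x<..<z'} = {}" using lt[OF _ z(2)] unfolding P_def by fastforce
      show "P' z' \<inter> {x<..<z'} = {}" using zmin(2) unfolding P'_def by fastforce
      show "{x<..<z'} \<inter> {w<..<z} = {}" using zw by auto
      show "P' z' \<inter> {w<..<z} = {}"
      proof -
        have False if k: "k \<in> H'" "w < Suc k" "Suc k < z" for k
        proof -
          obtain q where "k < q" "q < z" "\<not> L q" using cross[OF z(1) k(1)] k by auto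
          then show False using w(3)[of q] k by auto
        qed
        then show ?thesis unfolding P'_def by fastforce
      qed
    qed
    then have "card H + card H' + (z' - 1 - x) + (z - 1 - w) \<le> c + 2" by simp
    then show ?thesis using z x w zw
      by (intro disjI2 bexI[of _ z] bexI[of _ z'] exI[of _ x] exI[of _ w]) auto
  qed
qed

lemma split_four:
  assumes "a \<le> b" "b \<le> c" "c \<le> d"
  shows "U = take a U @ drop a (take b U) @ drop b (take c U) @ drop c (take d U) @ drop d U"
proof -
  have *: "take a U @ drop a (take b U) = take b U" if "a \<le> b" for a b
    using that by (metis append_take_drop_id min.absorb1 take_take)
  show ?thesis using assms * by (metis append.assoc append_take_drop_id)
qed

lemma set_segment:
  assumes "b \<le> length U"
  shows "set (drop a (take b U)) = (!) U ` {a..<b}"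
proof (intro set_eqI iffI)
  fix x assume "x \<in> set (drop a (take b U))"
  then obtain i where "i < length (drop a (take b U))" "x = drop a (take b U) ! i"
    by (metis in_set_conv_nth)
  then show "x \<in> (!) U ` {a..<b}" using assms by (intro image_eqI[of _ _ "a + i"]) auto
next
  fix x assume "x \<in> (!) U ` {a..<b}"
  then obtain i where i: "a \<le> i" "i < b" "x = U ! i" by auto
  then have "x = drop a (take b U) ! (i - a)" "i - a < length (drop a (take b U))"
    using assms by auto
  then show "x \<in> set (drop a (take b U))" by (metis nth_mem)
qed

lemma hd_segment: "z < b \<Longrightarrow> b \<le> length U \<Longrightarrow> hd (drop z (take b U)) = U ! z"
  by (simp add: hd_drop_conv_nth)

lemma last_segment: "z \<le> b \<Longrightarrow> b < length U \<Longrightarrow> last (drop z (take (Suc b) U)) = U ! b"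
  by (simp add: take_Suc_conv_app_nth)

context two_conn
begin

text \<open>\<open>D\<close> is the interior of a detour from \<open>a\<close> to \<open>b\<close>
  off \<open>U\<close>. It is nonempty, so a mere edge does not count.\<close>

definition handle :: "'a list \<Rightarrow> 'a \<Rightarrow> 'a \<Rightarrow> 'a list \<Rightarrow> bool" where
  "handle U a b D \<longleftrightarrow> D \<noteq> [] \<and> pth D \<and> set D \<inter> set U = {} \<and> E a (hd D) \<and> E (last D) b"

text \<open>If the detours met, one could follow \<open>U\<close>, then \<open>D'\<close> up to the
  first vertex of \<open>D\<close> lying on it, then \<open>D\<close> backwards to
  \<open>hd U\<close>: a cycle through all of \<open>U\<close>.\<close>

lemma handle_disjoint:
  assumes U: "pth U" "2 \<le> length U" and nocyc: "\<And>C. cyc C \<Longrightarrow> \<not> set U \<subseteq> set C"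
    and D: "handle U (hd U) b D" and D': "handle U (last U) b' D'"
  shows "set D \<inter> set D' = {}"
proof (rule ccontr)
  assume "set D \<inter> set D' \<noteq> {}"
  then have "\<exists>y\<in>set D. y \<in> set D'" by blast
  from split_list_first_prop[OF this] obtain D1 y D2 where
    d: "D = D1 @ y # D2" "y \<in> set D'" "\<forall>u\<in>set D1. u \<notin> set D'" by blast
  obtain E1 E2 where e: "D' = E1 @ y # E2" using split_list[OF d(2)] by blast
  have h: "pth D" "pth D'" "set D \<inter> set U = {}" "set D' \<inter> set U = {}" "E (hd U) (hd D)" "E (last U) (hd D')"
    using D D' by (auto simp: handle_def)
  have Une: "U \<noteq> []" using U(2) by auto
  define C where "C = U @ (E1 @ [y]) @ rev D1"
  have p1: "pth (E1 @ [y])" using h(2) by (auto simp: e pth_append pth_Cons)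
  have p2: "pth D1" "D1 \<noteq> [] \<Longrightarrow> E (last D1) y" using h(1) by (auto simp: d pth_append)
  have h1: "hd (E1 @ [y]) = hd D'" by (cases E1) (auto simp: e)
  have dis: "set (E1 @ [y]) \<inter> set (rev D1) = {}" "set U \<inter> set ((E1 @ [y]) @ rev D1) = {}"
    using d h(3,4) e by auto
  have "pth ((E1 @ [y]) @ rev D1)"
    unfolding pth_append[of "E1 @ [y]"] using p1 p2 dis(1) E_sym by (auto simp: hd_rev)
  then have "pth C" unfolding C_def pth_append[of U]
    using U(1) dis(2) h(6) h1 by (auto simp: hd_append)
  moreover have "E (last C) (hd C)"
  proof (cases D1)
    case Nil
    then show ?thesis using h(5) E_sym Une by (simp add: C_def d)
  next
    case (Cons v vs)
    then show ?thesis using h(5) E_sym Une by (simp add: C_def d)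
  qed
  moreover have "3 \<le> length C" using U(2) by (simp add: C_def)
  ultimately have "cyc C" by (simp add: cyc_def)
  from nocyc[OF this] show False by (auto simp: C_def)
qed

text \<open>The classical exchange for crossing chords, with detours as chords. Only the vertices
  strictly between positions \<open>k'\<close> and \<open>k\<close> are lost, so when no cycle
  contains all vertices of \<open>X\<close> on \<open>U\<close>, one of them must lie there.\<close>

lemma handle_cross_cycle:
  assumes U: "pth U" and D: "handle U (hd U) (U ! k) D" and D': "handle U (last U) (U ! k') D'"
    and dis: "set D \<inter> set D' = {}" and k: "k' < k" "k < length U"
  shows "cyc (take (Suc k') U @ rev D' @ rev (drop k U) @ rev D)"
proof -
  have h: "pth D" "pth D'" "set D \<inter> set U = {}" "set D' \<inter> set U = {}" "D \<noteq> []" "D' \<noteq> []"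
    "E (hd U) (hd D)" "E (last U) (hd D')" "E (last D) (U ! k)" "E (last D') (U ! k')"
    using D D' by (auto simp: handle_def)
  have sub: "set (take (Suc k') U) \<subseteq> set U" "set (drop k U) \<subseteq> set U"
    by (auto dest: in_set_takeD in_set_dropD)
  have dU: "distinct U" using U by (simp add: pth_def)
  have ne: "U \<noteq> []" "take (Suc k') U \<noteq> []" "drop k U \<noteq> []" using k by auto
  have "pth (take (Suc k') U @ drop (Suc k') U)" "pth (take k U @ drop k U)" using U by auto
  then have pp: "pth (take (Suc k') U)" "pth (drop k U)" unfolding pth_append by auto
  have td: "set (take (Suc k') U) \<inter> set (drop k U) = {}"
    using set_take_disj_set_drop_if_distinct[OF dU, of "Suc k'" k] k by auto
  have lt: "last (take (Suc k') U) = U ! k'" using k by (simp add: take_Suc_conv_app_nth)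
  have ld: "last (drop k U) = last U" "hd (drop k U) = U ! k" using k by (auto simp: hd_drop_conv_nth)
  have s: "E (U ! k') (last D')" "E (hd D') (last U)" "E (U ! k) (last D)" "E (hd D) (hd U)"
    using h E_sym by auto
  have p3: "pth (rev (drop k U) @ rev D)"
    unfolding pth_append using pp h s ld ne sub by (auto simp: hd_rev last_rev)
  have p2: "pth (rev D' @ rev (drop k U) @ rev D)"
    unfolding pth_append[of "rev D'"]
    using p3 pp h s ld ne sub dis by (auto simp: hd_rev last_rev)
  have "pth (take (Suc k') U @ rev D' @ rev (drop k U) @ rev D)"
    unfolding pth_append[of "take (Suc k') U"]
    using p2 pp h s ld lt ne sub td by (auto simp: hd_rev last_rev)
  moreover have "E (last (take (Suc k') U @ rev D' @ rev (drop k U) @ rev D))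
      (hd (take (Suc k') U @ rev D' @ rev (drop k U) @ rev D))"
    using h s ne by (simp add: last_rev)
  moreover have "1 \<le> length D" "1 \<le> length D'" "1 \<le> length (drop k U)"
    using h k by (auto simp: Suc_le_eq)
  then have "3 \<le> length (take (Suc k') U @ rev D' @ rev (drop k U) @ rev D)"
    by simp
  ultimately show ?thesis by (simp add: cyc_def)
qed

text \<open>Turns the choice made by \<open>gap_count\<close> into a path. Each abandoned run is
  bounded on the side away from its attachment by a vertex of \<open>X\<close>, and this vertex
  becomes an end of \<open>W\<close>; hence both ends lie in \<open>X\<close> and no vertex of
  \<open>X\<close> on \<open>U\<close> is lost.\<close>

lemma handle_paths:
  assumes U: "pth U" "2 \<le> length U" "hd U \<in> X" "last U \<in> X"
    and nocyc: "\<And>C. cyc C \<Longrightarrow> \<not> set U \<inter> X \<subseteq> set C"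
    and H: "H \<subseteq> {1..<length U - 1}" "H \<noteq> {}"
      "\<And>z. z \<in> H \<Longrightarrow> \<exists>D. handle U (hd U) (U ! z) D \<and> set D \<inter> X = {} \<and> g \<le> length D"
      "card H = 1 \<or> (\<forall>k\<in>H. U ! (k - 1) \<notin> X)"
    and H': "H' \<subseteq> {1..<length U - 1}" "H' \<noteq> {}"
      "\<And>z. z \<in> H' \<Longrightarrow> \<exists>D. handle U (last U) (U ! z) D \<and> set D \<inter> X = {} \<and> g' \<le> length D"
      "card H' = 1 \<or> (\<forall>k\<in>H'. U ! (Suc k) \<notin> X)"
  shows "\<exists>W. pth W \<and> W \<noteq> [] \<and> hd W \<in> X \<and> last W \<in> X \<and> set U \<inter> X \<subseteq> set W \<and>
    card H + card H' + g + g' \<le> card (set W - X) + 2"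
proof -
  define m where "m = length U"
  define L where "L i \<longleftrightarrow> i < m \<and> U ! i \<notin> X" for i
  have m: "2 \<le> m" using U by (simp add: m_def)
  have Une: "U \<noteq> []" using U(2) by auto
  have dU: "distinct U" using U(1) by (simp add: pth_def)
  have hl: "hd U = U ! 0" "last U = U ! (m - 1)"
    using Une by (simp_all add: hd_conv_nth last_conv_nth m_def)
  have nocyc': "\<And>C. cyc C \<Longrightarrow> \<not> set U \<subseteq> set C" using nocyc by blast
  have disj: "set D \<inter> set D' = {}"
    if "handle U (hd U) b D" "handle U (last U) b' D'" for b b' D D'
    by (rule handle_disjoint[OF U(1,2) nocyc' that])
  have L0: "\<not> L 0" "\<not> L (m - 1)" using U(3,4) hl by (auto simp: L_def)
  have cross: "\<exists>y. k' < y \<and> y < k \<and> \<not> L y" if k: "k \<in> H" "k' \<in> H'" "k' < k" for k k'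
  proof -
    have km: "k < length U" using H(1) k by auto
    obtain D where D: "handle U (hd U) (U ! k) D" using H(3) k by blast
    obtain D' where D': "handle U (last U) (U ! k') D'" using H'(3) k by blast
    from handle_cross_cycle[OF U(1) D D' disj[OF D D'] k(3) km]
    have "\<not> set U \<inter> X \<subseteq> set (take (Suc k') U @ rev D' @ rev (drop k U) @ rev D)"
      by (rule nocyc)
    then obtain u where u: "u \<in> set U" "u \<in> X" "u \<notin> set (take (Suc k') U)" "u \<notin> set (drop k U)"
      by auto
    obtain y where y: "y < m" "u = U ! y" using u(1) by (metis in_set_conv_nth m_def)
    have "\<not> y < Suc k'"
    proof
      assume "y < Suc k'"
      then have "u = take (Suc k') U ! y" "y < length (take (Suc k') U)" using y by (auto simp: m_def)
      then show False using u(3) nth_mem by metis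
    qed
    moreover have "\<not> k \<le> y"
    proof
      assume "k \<le> y"
      then have "u = drop k U ! (y - k)" "y - k < length (drop k U)" using y km by (auto simp: m_def)
      then show False using u(4) nth_mem by metis
    qed
    ultimately show ?thesis using y u(2) by (intro exI[of _ y]) (auto simp: L_def)
  qed
  define c where "c = card {i. i < m \<and> L i}"
  have c: "c = card (set U - X)"
  proof -
    have "{i. i < m \<and> L i} = {i. i < length U \<and> U ! i \<notin> X}" by (auto simp: L_def m_def)
    then have "c = card {y \<in> set U. y \<notin> X}"
      using card_nth_idx[OF dU, of "\<lambda>y. y \<notin> X"] by (simp add: c_def)
    also have "{y \<in> set U. y \<notin> X} = set U - X" by auto
    finally show ?thesis .
  qed
  have pre: "card H = 1 \<or> (\<forall>k\<in>H. L (k - 1))" "card H' = 1 \<or> (\<forall>k\<in>H'. L (Suc k))"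
  proof -
    have "k - 1 < m" if "k \<in> H" for k
      using subsetD[OF H(1) that] unfolding atLeastLessThan_iff m_def by linarith
    then show "card H = 1 \<or> (\<forall>k\<in>H. L (k - 1))" using H(4) by (auto simp: L_def)
    have "Suc k < m" if "k \<in> H'" for k
      using subsetD[OF H'(1) that] unfolding atLeastLessThan_iff m_def by linarith
    then show "card H' = 1 \<or> (\<forall>k\<in>H'. L (Suc k))" using H'(4) by (auto simp: L_def)
  qed
  have Hm: "H \<subseteq> {1..<m - 1}" "H' \<subseteq> {1..<m - 1}" using H(1) H'(1) by (auto simp: m_def)
  have segX: "set (drop a (take b U)) \<inter> X = {} \<and> card (set (drop a (take b U))) \<le> b - a"
    if "\<And>k. a \<le> k \<Longrightarrow> k < b \<Longrightarrow> L k" "b \<le> m" for a b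
  proof -
    have *: "set (drop a (take b U)) = (!) U ` {a..<b}"
      using set_segment that(2) by (simp add: m_def)
    have "card ((!) U ` {a..<b}) \<le> card {a..<b}" by (rule card_image_le) simp
    then show ?thesis unfolding * using that by (auto simp: L_def)
  qed
  \<comment> \<open>Balance of low vertices: those of \<open>U\<close> minus the two runs, plus the
    interiors of both detours, which are low, disjoint and off \<open>U\<close>.\<close>
  have count: "c + g + g' \<le> card (set W - X) + r + r'"
    if W: "set U \<subseteq> set W \<union> R \<union> R'" "set D \<subseteq> set W" "set D' \<subseteq> set W" "card R \<le> r" "card R' \<le> r'"
      and D: "handle U (hd U) b D" "set D \<inter> X = {}" "g \<le> length D"
      and D': "handle U (last U) b' D'" "set D' \<inter> X = {}" "g' \<le> length D'"
      and fin: "finite R" "finite R'"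
    for W R R' D D' b b' r r'
  proof -
    have dis: "set D \<inter> set D' = {}" by (rule disj[OF D(1) D'(1)])
    have h: "pth D" "pth D'" "set D \<inter> set U = {}" "set D' \<inter> set U = {}"
      using D D' by (auto simp: handle_def)
    define Q where "Q = set W - X - (set D \<union> set D')"
    have "set U - X \<subseteq> Q \<union> R \<union> R'" using W(1) h by (auto simp: Q_def)
    then have "c \<le> card (Q \<union> R \<union> R')"
      unfolding c by (rule card_mono[rotated]) (use fin in \<open>simp add: Q_def\<close>)
    also have "\<dots> \<le> card Q + r + r'"
      using card_Un_le[of "Q \<union> R" R'] card_Un_le[of Q R] W(4,5) by linarith
    finally have 1: "c \<le> card Q + r + r'" .
    have "set W - X = Q \<union> (set D \<union> set D')" using W(2,3) D(2) D'(2) by (auto simp: Q_def)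
    moreover have "card (Q \<union> (set D \<union> set D')) = card Q + card (set D \<union> set D')"
      by (rule card_Un_disjoint) (auto simp: Q_def)
    moreover have "card (set D \<union> set D') = length D + length D'"
      using dis pth_card[OF h(1)] pth_card[OF h(2)] by (simp add: card_Un_disjoint)
    ultimately have "card (set W - X) = card Q + (length D + length D')" by simp
    then show ?thesis using 1 D(3) D'(3) by linarith
  qed
  from gap_count[OF L0 _ Hm(1) H(2) Hm(2) H'(2) cross pre, folded c_def] m
  consider (N) z z' x y where "z \<in> H" "z' \<in> H'" "z \<le> z'" "x < z" "z' < y" "y < m" "\<not> L x" "\<not> L y"
      "\<And>k. x < k \<Longrightarrow> k < z \<Longrightarrow> L k" "\<And>k. z' < k \<Longrightarrow> k < y \<Longrightarrow> L k"
      "card H + card H' + (z - 1 - x) + (y - 1 - z') \<le> c + 2"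
    | (C) z z' x w where "z \<in> H" "z' \<in> H'" "x < z'" "z' < w" "w < z" "\<not> L x" "\<not> L w"
      "\<And>k. x < k \<Longrightarrow> k < z' \<Longrightarrow> L k" "\<And>k. w < k \<Longrightarrow> k < z \<Longrightarrow> L k"
      "card H + card H' + (z' - 1 - x) + (z - 1 - w) \<le> c + 2"
    by fastforce
  then show ?thesis
  proof cases
    case N
    obtain D where D: "handle U (hd U) (U ! z) D" "set D \<inter> X = {}" "g \<le> length D"
      using H(3) N(1) by blast
    obtain D' where D': "handle U (last U) (U ! z') D'" "set D' \<inter> X = {}" "g' \<le> length D'"
      using H'(3) N(2) by blast
    define P R M R' P' where "P = take (Suc x) U" and "R = drop (Suc x) (take z U)"
      and "M = drop z (take (Suc z') U)" and "R' = drop (Suc z') (take y U)" and "P' = drop y U"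
    have Ueq: "U = P @ R @ M @ R' @ P'"
      unfolding P_def R_def M_def R'_def P'_def by (rule split_four) (use N in auto)
    have zm: "z' < m" using N by simp
    have ne: "P \<noteq> []" "M \<noteq> []" "P' \<noteq> []"
      using N zm by (auto simp: P_def M_def P'_def m_def)
    have ends: "hd P = hd U" "last P = U ! x" "hd M = U ! z" "last M = U ! z'" "hd P' = U ! y" "last P' = last U"
    proof -
      have "x < length U" "z < Suc z'" "Suc z' \<le> length U" "y < length U" using N zm by (auto simp: m_def)
      then show "hd P = hd U" "last P = U ! x" "hd M = U ! z" "last M = U ! z'" "hd P' = U ! y" "last P' = last U"
        unfolding P_def M_def P'_def
        using hd_segment[of z "Suc z'" U] last_segment[of z z' U] last_segment[of 0 x U]
        by (auto simp: hd_drop_conv_nth)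
    qed
    have R: "set R \<inter> X = {}" "card (set R) \<le> z - 1 - x"
      using segX[of "Suc x" z] N zm by (auto simp: R_def)
    have R': "set R' \<inter> X = {}" "card (set R') \<le> y - 1 - z'"
      using segX[of "Suc z'" y] N zm by (auto simp: R'_def)
    \<comment> \<open>From \<open>U ! x\<close> back to the first vertex, along \<open>D\<close> to
      \<open>U ! z\<close>, on to \<open>U ! z'\<close>, along \<open>D'\<close> backwards to the
      last vertex, and back to \<open>U ! y\<close>.\<close>
    define W where "W = rev P @ D @ M @ rev D' @ rev P'"
    have "pth (P @ R @ M @ R' @ P')" using U(1) Ueq by simp
    then have pp: "pth P" "pth M" "pth P'" "set P \<inter> set M = {}" "set P \<inter> set P' = {}" "set M \<inter> set P' = {}"
      by (auto simp: pth_append)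
    have h: "pth D" "pth D'" "set D \<inter> set U = {}" "set D' \<inter> set U = {}" "D \<noteq> []" "D' \<noteq> []"
      "E (hd U) (hd D)" "E (last U) (hd D')" "E (last D) (U ! z)" "E (last D') (U ! z')"
      using D D' by (auto simp: handle_def)
    have sU: "set P \<subseteq> set U" "set M \<subseteq> set U" "set P' \<subseteq> set U" by (auto simp: Ueq)
    have dd: "set P \<inter> set D = {}" "set M \<inter> set D = {}" "set P' \<inter> set D = {}"
      "set P \<inter> set D' = {}" "set M \<inter> set D' = {}" "set P' \<inter> set D' = {}"
      using sU h by auto
    have dis: "set D \<inter> set D' = {}" by (rule disj[OF D(1) D'(1)])
    have s: "E (U ! z') (last D')" "E (hd D') (last U)" using h E_sym by auto
    have q4: "pth (rev D' @ rev P')"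
      unfolding pth_append using h pp dd s ends ne by (simp add: hd_rev last_rev Int_commute)
    have q3: "pth (M @ rev D' @ rev P')"
      unfolding pth_append[of M] using q4 h pp dd s ends ne
      by (simp add: hd_rev last_rev Int_Un_distrib)
    have q2: "pth (D @ M @ rev D' @ rev P')"
      unfolding pth_append[of D] using q3 h pp dd s ends ne dis
      by (simp add: hd_rev last_rev Int_Un_distrib Int_commute)
    have "pth W"
      unfolding W_def pth_append[of "rev P"] using q2 h pp dd s ends ne
      by (simp add: hd_rev last_rev Int_Un_distrib Int_commute)
    moreover have "hd W \<in> X" "last W \<in> X"
      using N ends ne by (auto simp: W_def hd_rev last_rev L_def)
    moreover have "set U \<inter> X \<subseteq> set W" using R R' by (subst Ueq) (auto simp: W_def)
    moreover have "c + g + g' \<le> card (set W - X) + (z - 1 - x) + (y - 1 - z')"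
    proof (rule count[OF _ _ _ R(2) R'(2) D D'])
      show "set U \<subseteq> set W \<union> set R \<union> set R'" by (subst Ueq) (auto simp: W_def)
    qed (auto simp: W_def)
    then have "card H + card H' + g + g' \<le> card (set W - X) + 2" using N(11) by linarith
    ultimately show ?thesis using ne by (intro exI[of _ W]) (auto simp: W_def)
  next
    case C
    obtain D where D: "handle U (hd U) (U ! z) D" "set D \<inter> X = {}" "g \<le> length D"
      using H(3) C(1) by blast
    obtain D' where D': "handle U (last U) (U ! z') D'" "set D' \<inter> X = {}" "g' \<le> length D'"
      using H'(3) C(2) by blast
    define P R M R' N where "P = take (Suc x) U" and "R = drop (Suc x) (take z' U)"
      and "M = drop z' (take (Suc w) U)" and "R' = drop (Suc w) (take z U)" and "N = drop z U"
    have Ueq: "U = P @ R @ M @ R' @ N"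
      unfolding P_def R_def M_def R'_def N_def by (rule split_four) (use C in auto)
    have zm: "z < m" using subsetD[OF Hm(1) C(1)] unfolding atLeastLessThan_iff by linarith
    have ne: "P \<noteq> []" "M \<noteq> []" "N \<noteq> []"
      using C zm by (auto simp: P_def M_def N_def m_def)
    have ends: "hd P = hd U" "last P = U ! x" "hd M = U ! z'" "last M = U ! w" "hd N = U ! z" "last N = last U"
    proof -
      have "x < length U" "z' < Suc w" "Suc w \<le> length U" "z < length U" using C zm by (auto simp: m_def)
      then show "hd P = hd U" "last P = U ! x" "hd M = U ! z'" "last M = U ! w" "hd N = U ! z" "last N = last U"
        unfolding P_def M_def N_def
        using hd_segment[of z' "Suc w" U] last_segment[of z' w U] last_segment[of 0 x U]
        by (auto simp: hd_drop_conv_nth)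
    qed
    have R: "set R \<inter> X = {}" "card (set R) \<le> z' - 1 - x"
      using segX[of "Suc x" z'] C zm by (auto simp: R_def)
    have R': "set R' \<inter> X = {}" "card (set R') \<le> z - 1 - w"
      using segX[of "Suc w" z] C zm by (auto simp: R'_def)
    \<comment> \<open>From \<open>U ! w\<close> back to \<open>U ! z'\<close>, along
      \<open>D'\<close> backwards to the last vertex, back to \<open>U ! z\<close>, along
      \<open>D\<close> backwards to the first vertex, and up to \<open>U ! x\<close>.\<close>
    define W where "W = rev M @ rev D' @ rev N @ rev D @ P"
    have "pth (P @ R @ M @ R' @ N)" using U(1) Ueq by simp
    then have pp: "pth P" "pth M" "pth N" "set P \<inter> set M = {}" "set P \<inter> set N = {}" "set M \<inter> set N = {}"
      by (auto simp: pth_append)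
    have h: "pth D" "pth D'" "set D \<inter> set U = {}" "set D' \<inter> set U = {}" "D \<noteq> []" "D' \<noteq> []"
      "E (hd U) (hd D)" "E (last U) (hd D')" "E (last D) (U ! z)" "E (last D') (U ! z')"
      using D D' by (auto simp: handle_def)
    have sU: "set P \<subseteq> set U" "set M \<subseteq> set U" "set N \<subseteq> set U" by (auto simp: Ueq)
    have dd: "set P \<inter> set D = {}" "set M \<inter> set D = {}" "set N \<inter> set D = {}"
      "set P \<inter> set D' = {}" "set M \<inter> set D' = {}" "set N \<inter> set D' = {}"
      using sU h by auto
    have dis: "set D \<inter> set D' = {}" by (rule disj[OF D(1) D'(1)])
    have s: "E (U ! z') (last D')" "E (hd D') (last U)" "E (U ! z) (last D)" "E (hd D) (hd U)"
      using h E_sym by auto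
    have q4: "pth (rev D @ P)"
      unfolding pth_append using h pp dd s ends ne by (simp add: hd_rev last_rev Int_commute)
    have q3: "pth (rev N @ rev D @ P)"
      unfolding pth_append[of "rev N"] using q4 h pp dd s ends ne
      by (simp add: hd_rev last_rev Int_Un_distrib Int_commute)
    have q2: "pth (rev D' @ rev N @ rev D @ P)"
      unfolding pth_append[of "rev D'"] using q3 h pp dd s ends ne dis
      by (simp add: hd_rev last_rev Int_Un_distrib Int_commute)
    have "pth W"
      unfolding W_def pth_append[of "rev M"] using q2 h pp dd s ends ne
      by (simp add: hd_rev last_rev Int_Un_distrib Int_commute)
    moreover have "hd W \<in> X" "last W \<in> X"
      using C zm ends ne by (auto simp: W_def hd_rev last_rev L_def)
    moreover have "set U \<inter> X \<subseteq> set W" using R R' by (subst Ueq) (auto simp: W_def)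
    moreover have "c + g + g' \<le> card (set W - X) + (z' - 1 - x) + (z - 1 - w)"
    proof (rule count[OF _ _ _ R(2) R'(2) D D'])
      show "set U \<subseteq> set W \<union> set R \<union> set R'" by (subst Ueq) (auto simp: W_def)
    qed (auto simp: W_def)
    then have "card H + card H' + g + g' \<le> card (set W - X) + 2" using C(10) by linarith
    ultimately show ?thesis using ne by (intro exI[of _ W]) (auto simp: W_def)
  qed
qed

end

section \<open>Paths with the most vertices of a given set\<close>

lemma finite_ex_max:
  fixes g :: "'b \<Rightarrow> nat"
  assumes "finite S" "S \<noteq> {}"
  shows "\<exists>p\<in>S. \<forall>q\<in>S. g q \<le> g p"
proof -
  have "Max (g ` S) \<in> g ` S" using assms by (intro Max_in) auto
  then obtain p where p: "p \<in> S" "g p = Max (g ` S)" by auto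
  have "\<forall>q\<in>S. g q \<le> g p" unfolding p(2) using assms by auto
  with p(1) show ?thesis by blast
qed

context two_conn
begin

text \<open>The index sum of the ends is kept out: whether a path qualifies then depends only on its
  vertex set, so reversals and rotations qualify too and can be compared by index sum.\<close>

definition xmax :: "'a set \<Rightarrow> 'a list \<Rightarrow> bool" where
  "xmax X p \<longleftrightarrow> pth p \<and> (\<forall>q. pth q \<longrightarrow> card (set q \<inter> X) \<le> card (set p \<inter> X)) \<and>
     (\<forall>q. pth q \<and> card (set q \<inter> X) = card (set p \<inter> X) \<longrightarrow> length q \<le> length p)"

lemma xmax_exists:
  fixes f :: "'a \<Rightarrow> nat"
  obtains p where "xmax X p" "\<And>q. xmax X q \<Longrightarrow> f (hd q) + f (last q) \<le> f (hd p) + f (last p)"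
proof -
  define P where "P = {p. pth p}"
  have "finite {p. set p \<subseteq> V \<and> distinct p}" using finV by (rule finite_subset_distinct)
  then have fin: "finite P" by (rule finite_subset[rotated]) (auto simp: P_def pth_def)
  have "[] \<in> P" by (simp add: P_def)
  then obtain p1 where p1: "p1 \<in> P" "\<forall>q\<in>P. card (set q \<inter> X) \<le> card (set p1 \<inter> X)"
    using finite_ex_max[OF fin, of "\<lambda>q. card (set q \<inter> X)"] by blast
  define P2 where "P2 = {q \<in> P. card (set q \<inter> X) = card (set p1 \<inter> X)}"
  have "finite P2" "P2 \<noteq> {}" using fin p1 by (auto simp: P2_def)
  then obtain p2 where p2: "p2 \<in> P2" "\<forall>q\<in>P2. length q \<le> length p2"
    using finite_ex_max[of P2 length] by blast
  have x2: "xmax X p2" using p1 p2 by (auto simp: xmax_def P2_def P_def)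
  define P3 where "P3 = {q. xmax X q}"
  have "P3 \<subseteq> P" by (auto simp: P3_def P_def xmax_def)
  then have "finite P3" using fin finite_subset by blast
  moreover have "P3 \<noteq> {}" using x2 by (auto simp: P3_def)
  ultimately obtain p where "p \<in> P3" "\<forall>q\<in>P3. f (hd q) + f (last q) \<le> f (hd p) + f (last p)"
    using finite_ex_max[of P3 "\<lambda>q. f (hd q) + f (last q)"] by blast
  then show thesis using that by (auto simp: P3_def)
qed

lemma xmax_perm:
  assumes "xmax X p" "pth q" "set q = set p"
  shows "xmax X q"
proof -
  have "length q = length p" using assms pth_card unfolding xmax_def by metis
  then show ?thesis using assms by (simp add: xmax_def)
qed

lemma xmax_rev: "xmax X p \<Longrightarrow> xmax X (rev p)"
  by (rule xmax_perm[of X p]) (auto simp: xmax_def)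

text \<open>A Posa rotation: the last vertex of \<open>A\<close> becomes the new first
  vertex.\<close>

lemma xmax_rotate:
  assumes "xmax X (A @ B)" "A \<noteq> []" "B \<noteq> []" "E (hd A) (hd B)"
  shows "xmax X (rev A @ B)"
proof (rule xmax_perm[OF assms(1)])
  show "pth (rev A @ B)" using assms by (auto simp: xmax_def pth_append last_rev)
qed auto

lemma xmax_full:
  assumes p: "xmax X p" and "p \<noteq> []"
  shows "nbrs (hd p) \<subseteq> set p"
proof
  fix u assume u: "u \<in> nbrs (hd p)"
  show "u \<in> set p"
  proof (rule ccontr)
    assume nu: "u \<notin> set p"
    then have q: "pth (u # p)"
      using p u E_sym E_V2 by (auto simp: xmax_def pth_Cons nbrs_def)
    have "card (set p \<inter> X) \<le> card (set (u # p) \<inter> X)" by (intro card_mono) auto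
    moreover have "card (set (u # p) \<inter> X) \<le> card (set p \<inter> X)" using p q unfolding xmax_def by blast
    ultimately have "card (set (u # p) \<inter> X) = card (set p \<inter> X)" by (rule le_antisym[rotated])
    then have "length (u # p) \<le> length p" using p q unfolding xmax_def by blast
    then show False by simp
  qed
qed

text \<open>Rotating at a neighbour of the first vertex makes the predecessor of that neighbour the
  new first vertex and keeps the last one, so its index is at most \<open>f (hd p)\<close>. These
  indices are distinct and differ from \<open>f (last p)\<close>, which gives strictness when
  \<open>f (last p)\<close> is in the range. Strictness matters at the end with the larger index,
  since alternative (iv) is a weak inequality while (iii) is strict.\<close>

lemma xmax_rank:
  assumes p: "xmax X p" "p \<noteq> []"
    and mx: "\<And>q. xmax X q \<Longrightarrow> f (hd q) + f (last q) \<le> f (hd p) + f (last p)"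
    and f: "inj_on f V" "\<And>v. v \<in> V \<Longrightarrow> 1 \<le> f v"
  shows "deg (hd p) \<le> f (hd p) \<and> (f (last p) < f (hd p) \<longrightarrow> deg (hd p) < f (hd p))"
proof -
  define m where "m = length p"
  define S where "S = {s. s < length p \<and> E (p ! 0) (p ! s)}"
  have pp: "pth p" using p by (simp add: xmax_def)
  then have dp: "distinct p" "set p \<subseteq> V" by (auto simp: pth_def)
  have hl: "hd p = p ! 0" "last p = p ! (m - 1)" using p(2) by (auto simp: hd_conv_nth last_conv_nth m_def)
  have "card S = card {y \<in> set p. E (p ! 0) y}" unfolding S_def by (rule card_nth_idx[OF dp(1)])
  also have "{y \<in> set p. E (p ! 0) y} = nbrs (hd p)"
    using xmax_full[OF p] hl by (auto simp: nbrs_def)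
  finally have cS: "card S = deg (hd p)" by (simp add: deg_def)
  have Sb: "1 \<le> s \<and> s < m" if "s \<in> S" for s
  proof -
    have "s \<noteq> 0" using that E_irrefl by (auto simp: S_def intro: gr0I)
    then show ?thesis using that by (auto simp: S_def m_def)
  qed
  have inV: "p ! i \<in> V" if "i < m" for i using that dp(2) by (auto simp: m_def)
  define h where "h s = f (p ! (s - 1))" for s
  have inj: "inj_on h S"
  proof (rule inj_onI)
    fix a b assume ab: "a \<in> S" "b \<in> S" "h a = h b"
    have *: "a - 1 < m" "b - 1 < m" using Sb[OF ab(1)] Sb[OF ab(2)] by auto
    then have "p ! (a - 1) = p ! (b - 1)" using ab(3) f(1) inV by (auto simp: h_def inj_on_def)
    then have "a - 1 = b - 1" using dp(1) * by (simp add: nth_eq_iff_index_eq m_def)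
    then show "a = b" using Sb[OF ab(1)] Sb[OF ab(2)] by linarith
  qed
  have img: "h s \<in> {1..f (hd p)} - {f (last p)}" if s: "s \<in> S" for s
  proof -
    have sb: "1 \<le> s" "s < m" using Sb[OF s] by auto
    have ne: "take s p \<noteq> []" "drop s p \<noteq> []" using sb p(2) by (auto simp: m_def)
    have hh: "hd (take s p) = p ! 0" "hd (drop s p) = p ! s"
      using sb hl p(2) by (auto simp: m_def hd_drop_conv_nth)
    have "xmax X (rev (take s p) @ drop s p)"
      by (rule xmax_rotate) (use p ne hh s in \<open>auto simp: S_def\<close>)
    from mx[OF this] have "f (last (take s p)) + f (last p) \<le> f (hd p) + f (last p)"
      using ne sb by (simp add: hd_rev m_def)
    moreover have "last (take s p) = p ! (s - 1)"
      using sb ne by (simp add: last_conv_nth m_def)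
    ultimately have 1: "h s \<le> f (hd p)" by (simp add: h_def)
    have 2: "1 \<le> h s" using f(2) inV sb by (simp add: h_def)
    have "p ! (s - 1) \<noteq> p ! (m - 1)" using dp(1) sb by (auto simp: nth_eq_iff_index_eq m_def)
    then have "h s \<noteq> f (last p)" using f(1) inV sb hl by (auto simp: h_def inj_on_def)
    then show ?thesis using 1 2 by simp
  qed
  have "h ` S \<subseteq> {1..f (hd p)} - {f (last p)}" using img by (rule image_subsetI)
  then have "card S \<le> card ({1..f (hd p)} - {f (last p)})"
    by (rule card_inj_on_le[OF inj]) simp
  moreover have "last p \<in> V" using p(2) dp(2) by auto
  then have "1 \<le> f (last p)" by (rule f(2))
  then have "f (last p) < f (hd p) \<Longrightarrow> f (last p) \<in> {1..f (hd p)}" by simp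
  then have "f (last p) < f (hd p) \<Longrightarrow> card ({1..f (hd p)} - {f (last p)}) < f (hd p)"
    by (metis card_Diff1_less card_atLeastAtMost diff_Suc_1 finite_atLeastAtMost)
  moreover have "card ({1..f (hd p)} - {f (last p)}) \<le> f (hd p)"
    by (metis card_Diff1_le card_atLeastAtMost diff_Suc_1)
  ultimately show ?thesis using cS by linarith
qed

lemma cyc_rotate:
  assumes "cyc C" "y \<in> set C"
  obtains C' where "pth (y # C')" "set (y # C') = set C"
proof -
  obtain C1 C2 where C: "C = C1 @ y # C2" using split_list[OF assms(2)] by blast
  have c: "pth (C1 @ y # C2)" "E (last (y # C2)) (hd (C1 @ y # C2))"
    using assms(1) by (simp_all add: cyc_def C)
  have "pth ((y # C2) @ C1)"
    unfolding pth_append using c by (auto simp: pth_append hd_append)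
  then show thesis using that[of "C2 @ C1"] by (auto simp: C)
qed

text \<open>Such a cycle misses a vertex of \<open>X\<close>. A path from a missed vertex to the
  cycle, followed by the opened cycle, has more vertices of \<open>X\<close> than the cycle
  has.\<close>

lemma xmax_cyc:
  assumes p: "xmax X p" and X: "X \<subseteq> V" and C: "cyc C" "length C < card X"
  shows "card (set C \<inter> X) < card (set p \<inter> X)"
proof (rule ccontr)
  assume neg: "\<not> ?thesis"
  have "\<not> X \<subseteq> set C"
  proof
    assume "X \<subseteq> set C"
    then have "card X \<le> card (set C)" by (intro card_mono) auto
    then show False using C(2) card_length[of C] by linarith
  qed
  then have *: "(X - set C) \<inter> V \<noteq> {}" using X by blast
  have "C \<noteq> []" "set C \<subseteq> V" using C by (auto simp: cyc_def pth_def)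
  then have **: "set C \<inter> V \<noteq> {}" by (simp add: Int_absorb2)
  obtain F where F: "F \<noteq> []" "pth F" "hd F \<in> X - set C" "last F \<in> set C"
    "set F \<inter> set C = {last F}"
    using fan_conn[OF * **] by metis
  obtain C' where C': "pth (last F # C')" "set (last F # C') = set C"
    using cyc_rotate[OF C(1) F(4)] .
  define F' where "F' = butlast F"
  have Feq: "F = F' @ [last F]" using F(1) by (simp add: F'_def)
  have pF: "pth (F' @ [last F])" using F(2) Feq by simp
  then have lF: "last F \<notin> set F'" by (auto simp: pth_append)
  have "set F' \<inter> set C = {}"
  proof -
    have "set F' \<subseteq> set F" using Feq by (metis Un_upper1 set_append)
    then have "set F' \<inter> set C \<subseteq> {last F}" using F(5) by blast
    then show ?thesis using lF by blast
  qed
  then have dis: "set F' \<inter> set (last F # C') = {}" using C'(2) by simp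
  have q: "pth (F' @ last F # C')"
    unfolding pth_append using pF C'(1) dis by (auto simp: pth_append)
  have "hd F \<noteq> last F" using F(3,4) by auto
  then have "F' \<noteq> []" using Feq by (metis append_Nil list.sel(1))
  then have "hd F \<in> set F'" using Feq by (metis hd_append2 hd_in_set)
  then have "insert (hd F) (set C \<inter> X) \<subseteq> set (F' @ last F # C') \<inter> X"
    using F(3) C'(2) by auto
  then have "card (insert (hd F) (set C \<inter> X)) \<le> card (set (F' @ last F # C') \<inter> X)"
    by (intro card_mono) auto
  moreover have "card (set (F' @ last F # C') \<inter> X) \<le> card (set p \<inter> X)"
    using p q unfolding xmax_def by blast
  ultimately show False using neg F(3) by simp
qed

lemma xmax_length:
  assumes p: "xmax X p" "p \<noteq> []"
  shows "Suc (deg (hd p)) \<le> length p"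
proof -
  have "nbrs (hd p) \<subseteq> set p - {hd p}" using xmax_full[OF p] E_irrefl by (auto simp: nbrs_def)
  then have "deg (hd p) \<le> card (set p - {hd p})" unfolding deg_def by (intro card_mono) auto
  moreover have "card (set p) = length p" using p pth_card by (simp add: xmax_def)
  moreover have "card (set p - {hd p}) < card (set p)" using p(2) by (intro card_Diff1_less) simp_all
  ultimately show ?thesis by linarith
qed

text \<open>In the cycle lemma a cycle containing \<open>p\<close> is excluded by
  \<open>xmax_cyc\<close>, and the degrees on the path are the full degrees by
  \<open>xmax_full\<close>.\<close>

lemma xmax_deg:
  assumes p: "xmax X p" "p \<noteq> []" and X: "X \<subseteq> V" "c \<le> card X"
    and nc: "\<And>C. cyc C \<Longrightarrow> length C < c"
  shows "deg (hd p) + deg (last p) < c"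
proof -
  have pp: "pth p" using p by (simp add: xmax_def)
  have "hd p \<in> V" using pp p(2) by (auto simp: pth_def)
  then have "3 \<le> length p" using xmax_length[OF p] deg_ge2 by fastforce
  from cycle_lemma[OF pp this] obtain C where C: "cyc C"
    "set p \<subseteq> set C \<or> card (nbrs (hd p) \<inter> set p) + card (nbrs (last p) \<inter> set p) \<le> length C"
    by blast
  have "\<not> set p \<subseteq> set C"
  proof
    assume "set p \<subseteq> set C"
    then have "card (set p \<inter> X) \<le> card (set C \<inter> X)" by (intro card_mono) auto
    moreover have "card (set C \<inter> X) < card (set p \<inter> X)"
      using xmax_cyc[OF p(1) X(1) C(1)] nc[OF C(1)] X(2) by simp
    ultimately show False by simp
  qed
  moreover have "nbrs (hd p) \<inter> set p = nbrs (hd p)" using xmax_full[OF p] by blast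
  moreover have "nbrs (last p) \<inter> set p = nbrs (last p)"
    using xmax_full[OF xmax_rev[OF p(1)]] p(2) by (auto simp: hd_rev)
  ultimately have "deg (hd p) + deg (last p) \<le> length C" using C(2) by (simp add: deg_def)
  then show ?thesis using nc[OF C(1)] by simp
qed

text \<open>Detours from the first vertex of \<open>U\<close> come in two kinds: the cut-off piece
  \<open>P\<close> itself, attached at every neighbour of \<open>hd P\<close> further along
  \<open>U\<close>, or a single ear if there is no such neighbour. The sum \<open>card H + g\<close>
  trades the number of attachments against the length of the detour, so that it covers the degree of
  \<open>hd P\<close> either way.\<close>

lemma left_handles:
  assumes p: "xmax X (P @ U @ S)" and PS: "P \<noteq> []" "S \<noteq> []" "set P \<inter> X = {}"
    and U: "2 \<le> length U" "hd U \<in> X"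
    and noX: "\<And>q. xmax X q \<Longrightarrow> last q = last S \<Longrightarrow> hd q \<notin> X"
    and nocyc: "\<And>C. cyc C \<Longrightarrow> \<not> set U \<inter> X \<subseteq> set C"
  shows "\<exists>H g. H \<subseteq> {1..<length U - 1} \<and> H \<noteq> {} \<and>
    (\<forall>z\<in>H. \<exists>D. handle U (hd U) (U ! z) D \<and> set D \<inter> X = {} \<and> g \<le> length D) \<and>
    (card H = 1 \<or> (\<forall>k\<in>H. U ! (k - 1) \<notin> X)) \<and> deg (hd P) \<le> card H + g"
proof -
  have Une: "U \<noteq> []" using U by auto
  have pp: "pth (P @ U @ S)" using p by (simp add: xmax_def)
  then have q: "pth P" "pth U" "pth S" "set P \<inter> set U = {}" "set P \<inter> set S = {}" "set U \<inter> set S = {}"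
    "E (last P) (hd U)" "E (last U) (hd S)"
    using PS Une by (auto simp: pth_append)
  have full: "nbrs (hd P) \<subseteq> set P \<union> set U \<union> set S"
    using xmax_full[OF p] PS by auto
  have notS: False if yS: "y \<in> set S" and Ey: "E (hd P) y" for y
  proof -
    obtain S1 S2 where S: "S = S1 @ y # S2" using split_list[OF yS] by blast
    have "pth ((P @ U @ S1 @ [y]) @ S2)" using pp by (simp add: S)
    then have "pth (P @ U @ S1 @ [y])" unfolding pth_append[of "P @ U @ S1 @ [y]"] by blast
    moreover have "1 \<le> length P" using PS(1) by (simp add: Suc_le_eq)
    ultimately have "cyc (P @ U @ S1 @ [y])"
      using Ey E_sym PS U by (simp add: cyc_def)
    from nocyc[OF this] show False by auto
  qed
  have hU: "hd U = U ! 0" using Une by (simp add: hd_conv_nth)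
  define H where "H = {k. 1 \<le> k \<and> k < length U \<and> E (hd P) (U ! k)}"
  show ?thesis
  proof (cases "H = {}")
    case False
    have last_bound: "k < length U - 1" if "k \<in> H" for k
    proof (rule ccontr)
      assume "\<not> k < length U - 1"
      then have "U ! k = last U" using that Une by (auto simp: H_def last_conv_nth intro!: arg_cong[of _ _ "(!) U"])
      then have "E (last U) (hd P)" using that E_sym by (auto simp: H_def)
      moreover have "pth (P @ U)" using q PS by (auto simp: pth_append)
      moreover have "1 \<le> length P" using PS(1) by (simp add: Suc_le_eq)
      ultimately have "cyc (P @ U)" using PS Une U(1) by (simp add: cyc_def)
      from nocyc[OF this] show False by auto
    qed
    have hD: "handle U (hd U) (U ! z) (rev P) \<and> set (rev P) \<inter> X = {} \<and> length P \<le> length (rev P)"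
      if "z \<in> H" for z
      using that q PS E_sym by (auto simp: handle_def H_def hd_rev last_rev)
    \<comment> \<open>Rotating at \<open>U ! k\<close> yields a path starting at its predecessor and
      ending as before, so \<open>noX\<close> applies.\<close>
    have pred: "U ! (k - 1) \<notin> X" if k: "k \<in> H" for k
    proof -
      have kb: "1 \<le> k" "k < length U" "E (hd P) (U ! k)" using k by (auto simp: H_def)
      have "(P @ take k U) @ (drop k U @ S) = P @ U @ S" by (metis append.assoc append_take_drop_id)
      then have "xmax X ((P @ take k U) @ (drop k U @ S))" using p by (simp only:)
      moreover have "hd (drop k U @ S) = U ! k" using kb by (simp add: hd_drop_conv_nth)
      ultimately have "xmax X (rev (P @ take k U) @ (drop k U @ S))"
        using kb PS by (intro xmax_rotate) auto
      from noX[OF this] have "last (take k U) \<notin> X" using kb PS Une by (simp add: hd_rev)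
      moreover have "last (take k U) = U ! (k - 1)"
        using kb by (cases k) (auto simp: take_Suc_conv_app_nth)
      ultimately show ?thesis by simp
    qed
    \<comment> \<open>The neighbours are at most \<open>length P - 1\<close> vertices of
      \<open>P\<close>, possibly \<open>hd U\<close>, and one for each position in \<open>H\<close>;
      hence the degree is at most \<open>card H + length P\<close>.\<close>
    have "nbrs (hd P) \<subseteq> (set P - {hd P}) \<union> insert (hd U) ((!) U ` H)"
    proof
      fix y assume y: "y \<in> nbrs (hd P)"
      then have *: "y \<noteq> hd P" "E (hd P) y" using E_irrefl by (auto simp: nbrs_def)
      show "y \<in> (set P - {hd P}) \<union> insert (hd U) ((!) U ` H)"
      proof (cases "y \<in> set U")
        case True
        then obtain k where k: "k < length U" "y = U ! k" by (metis in_set_conv_nth)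
        show ?thesis
        proof (cases "k = 0")
          case True
          then show ?thesis using k hU by simp
        next
          case False
          then have "k \<in> H" using k * by (simp add: H_def)
          then show ?thesis using k by blast
        qed
      next
        case False
        then show ?thesis using full y notS * by blast
      qed
    qed
    then have "deg (hd P) \<le> card ((set P - {hd P}) \<union> insert (hd U) ((!) U ` H))"
      unfolding deg_def by (rule card_mono[rotated]) (auto simp: H_def)
    also have "\<dots> \<le> card (set P - {hd P}) + card (insert (hd U) ((!) U ` H))"
      by (rule card_Un_le)
    also have "card (insert (hd U) ((!) U ` H)) \<le> Suc (card ((!) U ` H))"
      by (rule card_insert_le_m1) auto
    also have "card ((!) U ` H) \<le> card H" by (rule card_image_le) (simp add: H_def)
    finally have "deg (hd P) \<le> card (set P - {hd P}) + Suc (card H)" by simp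
    moreover have "Suc (card (set P - {hd P})) = length P"
      using PS(1) pth_card[OF q(1)] by (metis List.finite_set card.remove hd_in_set)
    ultimately have "deg (hd P) \<le> card H + length P" by linarith
    moreover have "H \<subseteq> {1..<length U - 1}" using last_bound by (auto simp: H_def)
    ultimately show ?thesis using False hD pred by blast
  next
    case True
    \<comment> \<open>Now every neighbour of \<open>hd P\<close> lies in \<open>P\<close> or is
      \<open>hd U\<close>, at position \<open>length P\<close>. The ear starting there has an
      interior at least as long as the degree, so one attachment suffices.\<close>
    have hp: "(P @ U @ S) ! 0 = hd P" using PS(1) by (simp add: nth_append hd_conv_nth)
    have mx: "s \<le> length P" if s: "s < length (P @ U @ S)" "E ((P @ U @ S) ! 0) ((P @ U @ S) ! s)" for s
    proof (rule ccontr)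
      assume neg: "\<not> s \<le> length P"
      show False
      proof (cases "s < length P + length U")
        case True
        then have "s - length P < length U" using neg by linarith
        then have "(P @ U @ S) ! s = U ! (s - length P)" using neg by (simp add: nth_append)
        then have "s - length P \<in> H" using s True neg hp by (auto simp: H_def)
        then show False using \<open>H = {}\<close> by simp
      next
        case False
        then have "\<not> s - length P < length U" using neg by linarith
        then have "(P @ U @ S) ! s = S ! (s - length P - length U)" using neg by (simp add: nth_append)
        moreover have "S ! (s - length P - length U) \<in> set S" using s False by (intro nth_mem) auto
        ultimately show False using notS s hp by metis
      qed
    qed
    have "2 \<le> deg (hd P)" using deg_ge2 q(1) PS(1) by (simp add: pth_def subset_iff)
    then have "nbrs (hd P) \<noteq> {}" by (auto simp: deg_def)
    then obtain y where y: "E (hd P) y" "y \<in> set (P @ U @ S)" using full by (auto simp: nbrs_def)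
    then obtain s0 where s0: "s0 < length (P @ U @ S)" "E ((P @ U @ S) ! 0) ((P @ U @ S) ! s0)"
      using hp by (metis in_set_conv_nth)
    have len: "Suc (length P) < length (P @ U @ S)" using U(1) by simp
    have dp: "distinct (P @ U @ S)" using pp by (simp add: pth_def)
    have degS: "card {s. s < length (P @ U @ S) \<and> E ((P @ U @ S) ! 0) ((P @ U @ S) ! s)} = deg (hd P)"
    proof -
      have "{y \<in> set (P @ U @ S). E (hd P) y} = nbrs (hd P)" using full by (auto simp: nbrs_def)
      then show ?thesis using card_nth_idx[OF dp, of "E (hd P)"] hp by (simp add: deg_def)
    qed
    obtain F where F: "pth F" "F \<noteq> []" "hd F = (P @ U @ S) ! length P"
      "last F \<in> set (drop (Suc (length P)) (P @ U @ S))"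
      "set F \<inter> set (drop (length P) (P @ U @ S)) = {hd F, last F}" "deg (hd P) + 2 \<le> length F"
      using ear[OF pp len mx s0] unfolding degS by blast
    have hF: "hd F = hd U" using F(3) Une by (simp add: nth_append hU)
    have lF: "last F \<in> set (tl U) \<union> set S" using F(4) Une by (cases U) auto
    have US: "set F \<inter> (set U \<union> set S) = {hd U, last F}" using F(5) hF by simp
    obtain D where FD: "F = hd U # D @ [last F]"
    proof -
      obtain F1 where F1: "F = hd U # F1" using F(2) hF by (cases F) auto
      have "F1 \<noteq> []" using F(6) F1 by auto
      then have "F1 = butlast F1 @ [last F]" using F1 by simp
      then show thesis using that F1 by metis
    qed
    have "length F = length D + 2" by (subst FD) simp
    then have Dne: "D \<noteq> []" using F(6) \<open>2 \<le> deg (hd P)\<close> by auto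
    have pF: "pth (hd U # D @ [last F])" using F(1) FD by simp
    then have hd1: "pth D" "hd U \<notin> set D" "last F \<notin> set D" "hd U \<noteq> last F"
      "E (hd U) (hd D)" "E (last D) (last F)"
      using Dne by (auto simp: pth_Cons pth_append)
    have Ddis: "set D \<inter> (set U \<union> set S) = {}"
    proof -
      have False if "x \<in> set D" "x \<in> set U \<union> set S" for x
      proof -
        have "x \<in> set F" using that FD by (metis Un_iff list.set_intros(2) set_append)
        then have "x = hd U \<or> x = last F" using US that by blast
        then show False using hd1 that by blast
      qed
      then show ?thesis by blast
    qed
    \<comment> \<open>If \<open>D\<close> met \<open>X\<close> in \<open>y\<close>, the part of
      \<open>D\<close> up to \<open>y\<close>, reversed, could replace \<open>P\<close>: this gains
      \<open>y\<close> and loses nothing of \<open>X\<close>, as \<open>P\<close> contains none of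
      it.\<close>
    have DX: "set D \<inter> X = {}"
    proof (rule ccontr)
      assume "set D \<inter> X \<noteq> {}"
      then obtain y where y: "y \<in> set D" "y \<in> X" by blast
      obtain D1 D2 where D: "D = D1 @ y # D2" using split_list[OF y(1)] by blast
      have e: "pth (D1 @ [y])" "E (hd U) (hd (D1 @ [y]))"
        using hd1(1,5) by (auto simp: D pth_append pth_Cons hd_append split: if_splits)
      have "pth (U @ S)" using q PS Une by (auto simp: pth_append)
      moreover have "set (D1 @ [y]) \<inter> set (U @ S) = {}" using Ddis by (auto simp: D)
      moreover have "last (rev (D1 @ [y])) = hd (D1 @ [y])" by (cases D1) simp_all
      then have "E (last (rev (D1 @ [y]))) (hd (U @ S))" using E_sym[OF e(2)] Une by (simp only: hd_append2 simp_thms)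
      moreover have "pth (rev (D1 @ [y]))" using e(1) by (simp only: pth_rev)
      ultimately have pq: "pth (rev (D1 @ [y]) @ (U @ S))" unfolding pth_append[of "rev (D1 @ [y])"]
        by simp
      have "y \<notin> set (P @ U @ S)" using y PS(3) Ddis by auto
      then have "card (insert y (set (P @ U @ S) \<inter> X)) = Suc (card (set (P @ U @ S) \<inter> X))" by simp
      moreover have "insert y (set (P @ U @ S) \<inter> X) \<subseteq> set (rev (D1 @ [y]) @ (U @ S)) \<inter> X"
        using y PS(3) by auto
      then have "card (insert y (set (P @ U @ S) \<inter> X)) \<le> card (set (rev (D1 @ [y]) @ (U @ S)) \<inter> X)"
        by (intro card_mono) auto
      moreover have "card (set (rev (D1 @ [y]) @ (U @ S)) \<inter> X) \<le> card (set (P @ U @ S) \<inter> X)"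
        using p pq unfolding xmax_def by blast
      ultimately show False by linarith
    qed
    \<comment> \<open>If the ear ended at \<open>last U\<close> or in \<open>S\<close>, it would
      close a cycle through all of \<open>U\<close>.\<close>
    have closing: False if "pth (U @ S1)" "last F = last (U @ S1)" "set (U @ S1) \<subseteq> set U \<union> set S" for S1
    proof -
      have "set (U @ S1) \<inter> set (rev D) = {}" using Ddis that(3) by auto
      moreover have "E (last (U @ S1)) (hd (rev D))" using that(2) hd1(6) E_sym Dne by (simp add: hd_rev)
      ultimately have "pth ((U @ S1) @ rev D)"
        unfolding pth_append[of "U @ S1"] using that(1) hd1(1) by simp
      moreover have "E (last ((U @ S1) @ rev D)) (hd ((U @ S1) @ rev D))"
        using Dne Une hd1(5) E_sym by (simp add: last_rev)
      moreover have "1 \<le> length D" using Dne by (simp add: Suc_le_eq)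
      then have "3 \<le> length ((U @ S1) @ rev D)" using U(1) by simp
      ultimately have "cyc ((U @ S1) @ rev D)" by (simp add: cyc_def)
      from nocyc[OF this] show False by auto
    qed
    have "last F \<notin> set S"
    proof
      assume "last F \<in> set S"
      from split_list[OF this] obtain S1 S2 where S: "S = S1 @ last F # S2" by blast
      have "pth ((P @ U @ S1 @ [last F]) @ S2)" using pp by (simp add: S)
      then have "pth (P @ U @ S1 @ [last F])" unfolding pth_append[of "P @ U @ S1 @ [last F]"] by blast
      then have "pth (U @ (S1 @ [last F]))" unfolding pth_append[of P] by blast
      then show False by (rule closing) (auto simp: S)
    qed
    then have "last F \<in> set (tl U)" using lF by blast
    then obtain i where i: "i < length (tl U)" "last F = tl U ! i" by (metis in_set_conv_nth)
    define z where "z = Suc i"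
    have z: "z < length U" "last F = U ! z" "1 \<le> z" using i by (auto simp: z_def nth_tl)
    have "z \<noteq> length U - 1"
    proof
      assume "z = length U - 1"
      then have "last F = last (U @ [])" using z Une by (simp add: last_conv_nth)
      then show False using closing[of "[]"] q(2) by simp
    qed
    then have "{z} \<subseteq> {1..<length U - 1}" using z by auto
    moreover have "handle U (hd U) (U ! z) D" using hd1 Dne Ddis z by (auto simp: handle_def)
    moreover have "deg (hd P) \<le> length D" using F(6) by (subst (asm) FD) simp
    ultimately show ?thesis using DX by (intro exI[of _ "{z}"] exI[of _ "length D"]) auto
  qed
qed


text \<open>\<open>left_handles\<close> for the reversed path: position \<open>k\<close> becomes
  \<open>m - 1 - k\<close>, and predecessors become successors.\<close>

lemma right_handles:
  assumes p: "xmax X (P @ U @ S)" and PS: "P \<noteq> []" "S \<noteq> []" "set S \<inter> X = {}"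
    and U: "2 \<le> length U" "last U \<in> X"
    and noX: "\<And>q. xmax X q \<Longrightarrow> last q = hd P \<Longrightarrow> hd q \<notin> X"
    and nocyc: "\<And>C. cyc C \<Longrightarrow> \<not> set U \<inter> X \<subseteq> set C"
  shows "\<exists>H g. H \<subseteq> {1..<length U - 1} \<and> H \<noteq> {} \<and>
    (\<forall>z\<in>H. \<exists>D. handle U (last U) (U ! z) D \<and> set D \<inter> X = {} \<and> g \<le> length D) \<and>
    (card H = 1 \<or> (\<forall>k\<in>H. U ! Suc k \<notin> X)) \<and> deg (last S) \<le> card H + g"
proof -
  define m where "m = length U"
  have Une: "U \<noteq> []" using U by auto
  have "xmax X (rev S @ rev U @ rev P)" using xmax_rev[OF p] by simp
  then have "\<exists>H g. H \<subseteq> {1..<length (rev U) - 1} \<and> H \<noteq> {} \<and>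
    (\<forall>z\<in>H. \<exists>D. handle (rev U) (hd (rev U)) (rev U ! z) D \<and> set D \<inter> X = {} \<and> g \<le> length D) \<and>
    (card H = 1 \<or> (\<forall>k\<in>H. rev U ! (k - 1) \<notin> X)) \<and> deg (hd (rev S)) \<le> card H + g"
    by (rule left_handles) (use PS U Une noX nocyc in \<open>simp_all add: hd_rev last_rev\<close>)
  then obtain H g where H: "H \<subseteq> {1..<m - 1}" "H \<noteq> {}"
    and hd: "\<And>z. z \<in> H \<Longrightarrow> \<exists>D. handle (rev U) (hd (rev U)) (rev U ! z) D \<and> set D \<inter> X = {} \<and> g \<le> length D"
    and pr: "card H = 1 \<or> (\<forall>k\<in>H. rev U ! (k - 1) \<notin> X)" and dg: "deg (hd (rev S)) \<le> card H + g"
    unfolding length_rev m_def by blast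
  have b: "1 \<le> k \<and> k < m - 1" if "k \<in> H" for k
    using subsetD[OF H(1) that] by simp
  define H' where "H' = (\<lambda>k. m - 1 - k) ` H"
  have rn: "rev U ! k = U ! (m - 1 - k)" if "k < m" for k using that by (simp add: rev_nth m_def)
  have "inj_on (\<lambda>k. m - 1 - k) H" by (rule inj_onI) (use b in fastforce)
  then have c: "card H' = card H" by (simp add: H'_def card_image)
  have "H' \<subseteq> {1..<m - 1}"
  proof
    fix i assume "i \<in> H'"
    then obtain k where k: "k \<in> H" "i = m - 1 - k" by (auto simp: H'_def)
    then show "i \<in> {1..<m - 1}" using b[OF k(1)] by simp linarith
  qed
  moreover have "H' \<noteq> {}" using H(2) by (simp add: H'_def)
  moreover have "\<exists>D. handle U (last U) (U ! z) D \<and> set D \<inter> X = {} \<and> g \<le> length D" if zH: "z \<in> H'" for z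
  proof -
    obtain k where k: "k \<in> H" "z = m - 1 - k" using zH by (auto simp: H'_def)
    have "k < m" using b[OF k(1)] by linarith
    then show ?thesis using hd[OF k(1)] rn k(2) Une by (simp add: handle_def hd_rev)
  qed
  moreover have "card H' = 1 \<or> (\<forall>z\<in>H'. U ! Suc z \<notin> X)"
  proof -
    have "U ! Suc z \<notin> X" if all: "\<forall>k\<in>H. rev U ! (k - 1) \<notin> X" and z: "z \<in> H'" for z
    proof -
      obtain k where k: "k \<in> H" "z = m - 1 - k" using z by (auto simp: H'_def)
      have "k - 1 < m" "m - 1 - (k - 1) = Suc z" using b[OF k(1)] k(2) by auto
      then have "rev U ! (k - 1) = U ! Suc z" using rn[of "k - 1"] by simp
      then show ?thesis using all k(1) by metis
    qed
    note * = this
    show ?thesis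
    proof (cases "card H = 1")
      case False
      then have "\<forall>k\<in>H. rev U ! (k - 1) \<notin> X" using pr by blast
      then show ?thesis using * by blast
    qed (simp add: c)
  qed
  moreover have "deg (last S) \<le> card H' + g" using dg c PS by (simp add: hd_rev)
  ultimately show ?thesis unfolding m_def by blast
qed

text \<open>Two vertices of \<open>X\<close> are joined by some path, so \<open>p\<close> contains
  at least two of them, and its part from the first to the last is nontrivial.\<close>

lemma xmax_trim:
  assumes p: "xmax X p" and X: "X \<subseteq> V" "2 \<le> card X"
    and ends: "hd p \<notin> X" "last p \<notin> X"
  obtains P U S where "p = P @ U @ S" "P \<noteq> []" "S \<noteq> []" "set P \<inter> X = {}" "set S \<inter> X = {}"
    "2 \<le> length U" "hd U \<in> X" "last U \<in> X"
proof -
  have "2 \<le> card (set p \<inter> X)"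
  proof -
    obtain a b where ab: "a \<in> X" "b \<in> X" "a \<noteq> b"
    proof -
      obtain T where "T \<subseteq> X" "card T = 2" using obtain_subset_with_card_n[OF X(2)] by blast
      then show thesis using that by (auto simp: card_2_iff)
    qed
    then have *: "{a} \<inter> V \<noteq> {}" "{b} \<inter> V \<noteq> {}" using X(1) by auto
    obtain F where F: "F \<noteq> []" "pth F" "hd F \<in> {a}" "last F \<in> {b}"
      using fan_conn[OF *] by metis
    have "{a, b} \<subseteq> set F \<inter> X" using F ab hd_in_set[OF F(1)] last_in_set[OF F(1)] by auto
    then have "card {a, b} \<le> card (set F \<inter> X)" by (intro card_mono) auto
    moreover have "card (set F \<inter> X) \<le> card (set p \<inter> X)" using p F(2) unfolding xmax_def by blast
    ultimately show ?thesis using ab(3) by simp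
  qed
  define P where "P = takeWhile (\<lambda>v. v \<notin> X) p"
  define R where "R = dropWhile (\<lambda>v. v \<notin> X) p"
  have pR: "p = P @ R" by (simp add: P_def R_def)
  have PX: "set P \<inter> X = {}" by (auto simp: P_def dest: set_takeWhileD)
  define S where "S = rev (takeWhile (\<lambda>v. v \<notin> X) (rev R))"
  define U where "U = rev (dropWhile (\<lambda>v. v \<notin> X) (rev R))"
  have RU: "R = U @ S"
    by (simp add: U_def S_def flip: rev_append)
  have SX: "set S \<inter> X = {}" by (auto simp: S_def dest: set_takeWhileD)
  have peq: "p = P @ U @ S" using pR RU by simp
  have "set p \<inter> X \<subseteq> set U" using PX SX peq by auto
  then have "card (set p \<inter> X) \<le> card (set U)" by (intro card_mono) auto
  then have lU: "2 \<le> length U" using \<open>2 \<le> card (set p \<inter> X)\<close> card_length[of U] by linarith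
  then have Une: "U \<noteq> []" by auto
  have "last U \<in> X"
    using Une hd_dropWhile[of "\<lambda>v. v \<notin> X" "rev R"] by (simp add: U_def last_rev)
  moreover have "hd U \<in> X"
    using Une hd_dropWhile[of "\<lambda>v. v \<notin> X" p] RU by (simp add: R_def[symmetric])
  moreover have "P \<noteq> []" using ends(1) peq Une \<open>hd U \<in> X\<close> by (cases P) auto
  moreover have "S \<noteq> []" using ends(2) peq Une \<open>last U \<in> X\<close> by (cases S rule: rev_cases) auto
  ultimately show thesis using that peq PX SX lU by blast
qed

text \<open>Here \<open>f\<close> gives the index of a vertex. The bound
  \<open>2 * c <= n + 1\<close> is what makes n - (c - 1), the number of vertices left when c - 1
  are low, at least c.\<close>

lemma long_cycle:
  fixes f :: "'a \<Rightarrow> nat" and c n :: nat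
  assumes f: "inj_on f V" "f ` V = {1..n}" and n: "card V = n" and cn: "2 * c \<le> n + 1" "c \<le> n"
    and cond: "\<And>u v. u \<in> V \<Longrightarrow> v \<in> V \<Longrightarrow> f u < f v \<Longrightarrow>
      f u + f v < c \<or> E u v \<or> f u < deg u \<or> f v \<le> deg v \<or> c \<le> deg u + deg v"
  shows "\<exists>C. cyc C \<and> c \<le> length C"
proof (rule ccontr)
  assume "\<not> ?thesis"
  then have nc: "\<And>C. cyc C \<Longrightarrow> length C < c" by (meson not_le)
  have f1: "1 \<le> f v" "f v \<le> n" if "v \<in> V" for v using f(2) that by auto
  define t where "t = (LEAST s. \<exists>v\<in>V. deg v \<le> f v \<and> deg v = s)"
  have "\<exists>s. \<exists>v\<in>V. deg v \<le> f v \<and> deg v = s"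
  proof -
    have "n \<in> {1..n}" using V3 n by simp
    then obtain v where v: "v \<in> V" "f v = n" using f(2) by (metis imageE)
    have "deg v \<le> n" unfolding deg_def using nbrs_V finV n card_mono by metis
    then show ?thesis using v by auto
  qed
  from LeastI_ex[OF this] obtain e where e: "e \<in> V" "deg e = t" "t \<le> f e"
    unfolding t_def by auto
  have tmin: "t \<le> deg v" if "v \<in> V" "deg v \<le> f v" for v
    unfolding t_def by (rule Least_le) (use that in blast)
  have t2: "2 \<le> t" using deg_ge2[OF e(1)] e(2) by simp
  \<comment> \<open>At the ends of the chosen path alternatives (ii) to (v) all fail, which leaves
    (i). This is used with \<open>X = V\<close> for \<open>2 * t < c\<close>, and again for the
    actual \<open>X\<close>, whose definition involves \<open>t\<close>.\<close>
  have ends: "\<exists>p. xmax X p \<and> p \<noteq> [] \<and> t \<le> deg (hd p) \<and> t \<le> deg (last p) \<and> hd p \<in> V \<and> last p \<in> V \<and>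
      deg (hd p) \<le> f (hd p) \<and> deg (last p) \<le> f (last p) \<and> \<not> E (last p) (hd p) \<and>
      deg (hd p) + deg (last p) < c \<and> f (hd p) + f (last p) < c \<and> hd p \<noteq> last p"
    if X: "X \<subseteq> V" "c \<le> card X" "X \<noteq> {}" for X
  proof -
    obtain p where p: "xmax X p" and mx: "\<And>q. xmax X q \<Longrightarrow> f (hd q) + f (last q) \<le> f (hd p) + f (last p)"
      using xmax_exists by metis
    obtain v0 where "v0 \<in> X" using X(3) by blast
    then have "card (set [v0] \<inter> X) = 1" "pth [v0]" using X(1) by auto
    then have "1 \<le> card (set p \<inter> X)" using p unfolding xmax_def by metis
    then have pne: "p \<noteq> []" by auto
    have pp: "pth p" using p by (simp add: xmax_def)
    have inV: "hd p \<in> V" "last p \<in> V" using pp pne by (auto simp: pth_def)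
    have r1: "deg (hd p) \<le> f (hd p) \<and> (f (last p) < f (hd p) \<longrightarrow> deg (hd p) < f (hd p))"
      by (rule xmax_rank[OF p pne mx f(1) f1(1)])
    have r2: "deg (hd (rev p)) \<le> f (hd (rev p)) \<and>
        (f (last (rev p)) < f (hd (rev p)) \<longrightarrow> deg (hd (rev p)) < f (hd (rev p)))"
    proof (rule xmax_rank[OF xmax_rev[OF p] _ _ f(1) f1(1)])
      show "rev p \<noteq> []" using pne by simp
      show "f (hd q) + f (last q) \<le> f (hd (rev p)) + f (last (rev p))" if "xmax X q" for q
        using mx[OF that] pne by (simp add: hd_rev last_rev add.commute)
    qed
    then have r2': "deg (last p) \<le> f (last p)" "f (hd p) < f (last p) \<Longrightarrow> deg (last p) < f (last p)"
      using pne by (auto simp: hd_rev last_rev)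
    have d: "deg (hd p) + deg (last p) < c" by (rule xmax_deg[OF p pne X(1,2) nc])
    have l3: "3 \<le> length p" using xmax_length[OF p pne] deg_ge2[OF inV(1)] by linarith
    have ne: "hd p \<noteq> last p"
    proof -
      have "distinct p" using pp by (simp add: pth_def)
      then have "p ! 0 \<noteq> p ! (length p - 1)" using l3 by (subst nth_eq_iff_index_eq) auto
      then show ?thesis using pne by (simp add: hd_conv_nth last_conv_nth)
    qed
    have nadj: "\<not> E (last p) (hd p)"
    proof
      assume "E (last p) (hd p)"
      then have "cyc p" using pp l3 by (simp add: cyc_def)
      moreover have "length p < card X" using nc[OF \<open>cyc p\<close>] X(2) by simp
      ultimately show False using xmax_cyc[OF p X(1)] by blast
    qed
    have fne: "f (hd p) \<noteq> f (last p)" using f(1) inV ne by (auto simp: inj_on_def)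
    have "f (hd p) + f (last p) < c"
    proof (cases "f (hd p) < f (last p)")
      case True
      have "\<not> E (hd p) (last p)" using nadj E_sym by blast
      then show ?thesis using cond[OF inV True] r1 r2'(2)[OF True] d by linarith
    next
      case False
      then have lt: "f (last p) < f (hd p)" using fne by simp
      then show ?thesis using cond[OF inV(2,1) lt] r1 r2'(1) d nadj by linarith
    qed
    then show ?thesis using p pne tmin inV r1 r2'(1) nadj d ne by blast
  qed
  have Vne: "V \<noteq> {}" using V3 by auto
  have tc: "2 * t < c"
  proof -
    obtain p where "t \<le> deg (hd p)" "t \<le> deg (last p)" "deg (hd p) + deg (last p) < c"
      using ends[OF subset_refl _ Vne] n cn(2) by blast
    then show ?thesis by linarith
  qed

  \<comment> \<open>Low vertices and their number\<close>
  define X where "X = {v \<in> V. c \<le> deg v + t}"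
  define L where "L = V - X"
  have XV: "X \<subseteq> V" by (auto simp: X_def)
  have LX: "deg v + t < c" if "v \<in> L" for v using that by (auto simp: L_def X_def)
  have LV: "L \<subseteq> V" "finite L" using finV by (auto simp: L_def)
  have small: "card {v \<in> V. f v < k} \<le> k - 1" for k
  proof -
    have "card {v \<in> V. f v < k} \<le> card {1..<k}"
    proof (rule card_inj_on_le[of f])
      show "inj_on f {v \<in> V. f v < k}" using f(1) by (auto simp: inj_on_def)
      show "f ` {v \<in> V. f v < k} \<subseteq> {1..<k}" using f1 by auto
    qed simp
    then show ?thesis by simp
  qed
  \<comment> \<open>A low vertex of index at least c - t that is not adjacent to \<open>a\<close>
    violates every alternative: the index sum reaches c because \<open>f a\<close> is at least
    \<open>t\<close>, its degree is below c - t, and the degree sum is below c. The right-hand side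
    has at most (c - t - 1) + t = c - 1 elements.\<close>
  have Lsub: "L \<subseteq> {v \<in> V. f v < c - t} \<union> nbrs a"
    if a: "a \<in> V" "deg a = t" "t \<le> f a" "f a < c - t" for a
  proof
    fix v assume v: "v \<in> L"
    show "v \<in> {v \<in> V. f v < c - t} \<union> nbrs a"
    proof (rule ccontr)
      assume n: "v \<notin> {v \<in> V. f v < c - t} \<union> nbrs a"
      then have *: "\<not> E a v" "c - t \<le> f v" "v \<in> V" using v LV by (auto simp: nbrs_def)
      then have "f a < f v" using a by linarith
      from cond[OF a(1) *(3) this] show False using * a LX[OF v] tc by linarith
    qed
  qed
  have cL: "card L \<le> c - 1"
  proof (cases "f e < c - t")
    case True
    have "card L \<le> card ({v \<in> V. f v < c - t} \<union> nbrs e)"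
      by (rule card_mono[OF _ Lsub]) (use finV fin_nbrs e True in auto)
    also have "\<dots> \<le> card {v \<in> V. f v < c - t} + card (nbrs e)" by (rule card_Un_le)
    also have "\<dots> \<le> (c - t - 1) + t" using small[of "c - t"] e(2) by (simp add: deg_def)
    finally show ?thesis using tc t2 by linarith
  next
    case False
    \<comment> \<open>Now \<open>e\<close> has large index and may be low itself. Lowering the index
      threshold by one pays for adding \<open>e\<close>: (c - t - 2) + (t + 1) is again c - 1. The
      index sums still reach c because \<open>2 * t < c\<close>.\<close>
    have "L \<subseteq> {v \<in> V. f v < c - t - 1} \<union> insert e (nbrs e)"
    proof
      fix v assume v: "v \<in> L"
      show "v \<in> {v \<in> V. f v < c - t - 1} \<union> insert e (nbrs e)"
      proof (rule ccontr)
        assume n: "v \<notin> {v \<in> V. f v < c - t - 1} \<union> insert e (nbrs e)"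
        then have *: "\<not> E e v" "c - t - 1 \<le> f v" "v \<in> V" "v \<noteq> e"
          using v LV by (auto simp: nbrs_def)
        then have nE: "\<not> E v e" using E_sym by blast
        have "f v \<noteq> f e" using f(1) * e(1) by (auto simp: inj_on_def)
        then consider "f v < f e" | "f e < f v" by linarith
        then show False
        proof cases
          case 1
          from cond[OF *(3) e(1) 1] show False using * nE e LX[OF v] tc False by linarith
        next
          case 2
          from cond[OF e(1) *(3) 2] show False using 2 * e LX[OF v] tc False by linarith
        qed
      qed
    qed
    then have "card L \<le> card ({v \<in> V. f v < c - t - 1} \<union> insert e (nbrs e))"
      by (rule card_mono[rotated]) (use finV fin_nbrs in auto)
    also have "\<dots> \<le> card {v \<in> V. f v < c - t - 1} + card (insert e (nbrs e))" by (rule card_Un_le)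
    also have "\<dots> \<le> (c - t - 1 - 1) + Suc t"
      using small[of "c - t - 1"] e(2) card_insert_le_m1[of "Suc t" "nbrs e" e] by (simp add: deg_def)
    finally show ?thesis using tc t2 by linarith
  qed
  have "card X + card L = n"
  proof -
    have "finite X" using XV finV finite_subset by blast
    then show ?thesis using card_Diff_subset[of X V] XV n card_mono[OF finV XV] by (simp add: L_def)
  qed
  then have cX: "c \<le> card X" using cL cn tc by linarith
  have Xne: "X \<noteq> {}" using cX tc by auto

  \<comment> \<open>The extremal path and its ends\<close>
  obtain p where p: "xmax X p" "p \<noteq> []" "t \<le> deg (hd p)" "t \<le> deg (last p)" "hd p \<in> V" "last p \<in> V"
    "deg (hd p) \<le> f (hd p)" "deg (last p) \<le> f (last p)" "\<not> E (last p) (hd p)"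
    "deg (hd p) + deg (last p) < c" "f (hd p) + f (last p) < c" "hd p \<noteq> last p"
    using ends[OF XV cX Xne] by blast
  have few: "card (set C \<inter> X) < card (set p \<inter> X)" if "cyc C" for C
    using xmax_cyc[OF p(1) XV that] nc[OF that] cX by simp
  have vX: "hd p \<notin> X" "last p \<notin> X" using p by (auto simp: X_def)
  have pp: "pth p" using p(1) by (simp add: xmax_def)
  \<comment> \<open>The exact slack required by the final count. If one end has degree above
    \<open>t\<close>, the bound c - 1 on \<open>card L\<close> suffices; otherwise it must be
    improved to c - 2.\<close>
  have ineq: "card L + 2 * t + 2 \<le> c + deg (hd p) + deg (last p)"
  proof (cases "deg (hd p) = t \<and> deg (last p) = t")
    case False
    then have "2 * t + 1 \<le> deg (hd p) + deg (last p)" using p(3,4) by linarith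
    then show ?thesis using cL tc by linarith
  next
    case True
    \<comment> \<open>Both ends can serve as \<open>a\<close> in \<open>Lsub\<close>, so low
      vertices of index at least c - t are common neighbours. If all neighbours of the first vertex
      were common, the second vertex of \<open>p\<close> would be adjacent to the last one, and
      \<open>p\<close> without its low first vertex would close to a cycle keeping all its vertices
      of \<open>X\<close>. So there are at most \<open>t - 1\<close> common neighbours.\<close>
    define B where "B = nbrs (hd p) \<inter> nbrs (last p)"
    have fb: "f (hd p) < c - t" "f (last p) < c - t" using True p(7,8,11) by linarith+
    have "L \<subseteq> {v \<in> V. f v < c - t} \<union> nbrs (hd p)" "L \<subseteq> {v \<in> V. f v < c - t} \<union> nbrs (last p)"
      using Lsub p True fb by auto
    then have LB: "L \<subseteq> {v \<in> V. f v < c - t} \<union> B" unfolding B_def by blast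
    have "B \<noteq> nbrs (hd p)"
    proof
      assume BB: "B = nbrs (hd p)"
      obtain q where q: "p = hd p # q" using p(2) by (cases p) auto
      have len: "3 \<le> length q"
      proof -
        have "nbrs (hd p) \<subseteq> set p - {hd p, last p}"
          using xmax_full[OF p(1,2)] E_irrefl p(9) E_sym by (auto simp: nbrs_def)
        then have "deg (hd p) \<le> card (set p - {hd p, last p})" unfolding deg_def by (intro card_mono) auto
        moreover have "card (set p - {hd p, last p}) = card (set p) - 2"
          using p(2,12) by (subst card_Diff_subset) auto
        ultimately have "t + 2 \<le> length p" using pth_card[OF pp] True t2 by linarith
        moreover have "length p = Suc (length q)" by (subst q) simp
        ultimately show ?thesis using t2 by linarith
      qed
      have qne: "q \<noteq> []" using len by auto
      have "pth (hd p # q)" using pp q by simp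
      then have pq: "pth q" "E (hd p) (hd q)" using qne by (auto simp: pth_Cons)
      then have "hd q \<in> nbrs (last p)" using BB by (auto simp: nbrs_def B_def)
      moreover have "last p = last q" using q qne by (metis last_ConsR)
      ultimately have "cyc q" using pq(1) len by (simp add: cyc_def nbrs_def)
      moreover have "set p \<inter> X = set q \<inter> X"
      proof -
        have "set p = insert (hd p) (set q)" using q by (metis list.simps(15))
        then show ?thesis using vX(1) by auto
      qed
      ultimately show False using few[of q] by simp
    qed
    then have "B \<subset> nbrs (hd p)" by (auto simp: B_def)
    then have "card B < t" using psubset_card_mono[OF fin_nbrs, of B "hd p"] True by (simp add: deg_def)
    moreover have "card L \<le> card ({v \<in> V. f v < c - t} \<union> B)"
      by (rule card_mono[OF _ LB]) (use finV fin_nbrs in \<open>auto simp: B_def\<close>)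
    moreover have "card ({v \<in> V. f v < c - t} \<union> B) \<le> card {v \<in> V. f v < c - t} + card B" by (rule card_Un_le)
    ultimately show ?thesis using small[of "c - t"] True tc by linarith
  qed
  \<comment> \<open>An end in \<open>X\<close> has degree at least c - t; with degree at least
    \<open>t\<close> at the other end this contradicts \<open>xmax_deg\<close>.\<close>
  have noX: "hd q \<notin> X" if "xmax X q" "t \<le> deg (last q)" "q \<noteq> []" for q
    using xmax_deg[OF that(1,3) XV cX nc] that(2) by (auto simp: X_def)
  have X2: "2 \<le> card X" using cX tc t2 by linarith
  obtain P U S where U: "p = P @ U @ S" "P \<noteq> []" "S \<noteq> []" "set P \<inter> X = {}" "set S \<inter> X = {}"
    "2 \<le> length U" "hd U \<in> X" "last U \<in> X"
    using xmax_trim[OF p(1) XV X2 vX] .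
  have pU: "set p \<inter> X = set U \<inter> X" using U by auto
  have nocyc: "\<not> set U \<inter> X \<subseteq> set C" if C: "cyc C" for C
  proof
    assume "set U \<inter> X \<subseteq> set C"
    then have "card (set U \<inter> X) \<le> card (set C \<inter> X)" by (intro card_mono) auto
    then show False using few[OF C] pU by simp
  qed
  have ends2: "hd P = hd p" "last S = last p" using U by auto
  have xp: "xmax X (P @ U @ S)" using p(1) U(1) by simp
  have xne: "q \<noteq> []" if "xmax X q" for q
  proof
    assume "q = []"
    then have "card (set p \<inter> X) = 0" using that pp by (simp add: xmax_def)
    then show False using pU U(6,7) by (metis IntI List.finite_set card_0_eq empty_iff finite_Int hd_in_set list.size(3) not_numeral_le_zero)
  qed
  have nl: "hd q \<notin> X" if "xmax X q" "last q = last S" for q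
    by (rule noX[OF that(1) _ xne[OF that(1)]]) (use that(2) ends2 p(4) in simp)
  have nr: "hd q \<notin> X" if "xmax X q" "last q = hd P" for q
    by (rule noX[OF that(1) _ xne[OF that(1)]]) (use that(2) ends2 p(3) in simp)
  obtain H g where H: "H \<subseteq> {1..<length U - 1}" "H \<noteq> {}"
    "\<And>z. z \<in> H \<Longrightarrow> \<exists>D. handle U (hd U) (U ! z) D \<and> set D \<inter> X = {} \<and> g \<le> length D"
    "card H = 1 \<or> (\<forall>k\<in>H. U ! (k - 1) \<notin> X)" "deg (hd P) \<le> card H + g"
    using left_handles[OF xp U(2,3,4,6,7) nl nocyc] by blast
  obtain H' g' where H': "H' \<subseteq> {1..<length U - 1}" "H' \<noteq> {}"
    "\<And>z. z \<in> H' \<Longrightarrow> \<exists>D. handle U (last U) (U ! z) D \<and> set D \<inter> X = {} \<and> g' \<le> length D"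
    "card H' = 1 \<or> (\<forall>k\<in>H'. U ! (Suc k) \<notin> X)" "deg (last S) \<le> card H' + g'"
    using right_handles[OF xp U(2,3,5,6,8) nr nocyc] by blast
  have "pth (P @ U @ S)" using xp by (simp add: xmax_def)
  then have "pth U" by (simp add: pth_append)
  from handle_paths[OF this U(6,7,8) nocyc H(1-4) H'(1-4)] obtain W where
    W: "pth W" "W \<noteq> []" "hd W \<in> X" "last W \<in> X" "set U \<inter> X \<subseteq> set W"
      "card H + card H' + g + g' \<le> card (set W - X) + 2"
    by blast
  have Wlow: "deg (hd p) + deg (last p) \<le> card (set W - X) + 2"
    using H(5) H'(5) W(6) unfolding ends2 by linarith
  have full: "card (set q \<inter> X) \<le> card (set W \<inter> X)" if "pth q" for q
  proof -
    have "card (set q \<inter> X) \<le> card (set p \<inter> X)" using p(1) that unfolding xmax_def by blast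
    also have "\<dots> \<le> card (set W \<inter> X)" using W(5) unfolding pU by (intro card_mono) auto
    finally show ?thesis .
  qed
  have noext: "nbrs (hd q) - set W \<subseteq> L" if q: "pth q" "q \<noteq> []" "set q = set W" for q
  proof
    fix u assume u: "u \<in> nbrs (hd q) - set W"
    then have "u \<in> V" using nbrs_V by blast
    moreover have "u \<notin> X"
    proof
      assume uX: "u \<in> X"
      have "pth (u # q)" using q u E_sym \<open>u \<in> V\<close> by (auto simp: pth_Cons nbrs_def)
      from full[OF this] have "card (insert u (set W \<inter> X)) \<le> card (set W \<inter> X)" using uX q(3) by simp
      then show False using u by simp
    qed
    ultimately show "u \<in> L" by (simp add: L_def)
  qed

  \<comment> \<open>Counting low vertices on and off the rerouted path\<close>
  define O1 where "O1 = nbrs (hd W) - set W"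
  define O2 where "O2 = nbrs (last W) - set W"
  have O: "O1 \<subseteq> L" "O2 \<subseteq> L"
    using noext[of W] noext[of "rev W"] W by (auto simp: O1_def O2_def hd_rev)
  have lW: "3 \<le> length W"
  proof -
    have "2 \<le> card (set W - X)" using Wlow p(3,4) t2 by linarith
    moreover have "card (insert (hd W) (set W - X)) \<le> card (set W)"
      using W(2) by (intro card_mono) auto
    moreover have "card (insert (hd W) (set W - X)) = Suc (card (set W - X))" using W(3) by simp
    ultimately show ?thesis using pth_card[OF W(1)] by linarith
  qed
  have noW: "\<not> set W \<subseteq> set C" if "cyc C" for C
  proof
    assume "set W \<subseteq> set C"
    then show False using nocyc[OF that] W(5) by blast
  qed
  have dis: "O1 \<inter> O2 = {}"
  proof (rule ccontr)
    assume "O1 \<inter> O2 \<noteq> {}"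
    then obtain u where u: "E (hd W) u" "E (last W) u" "u \<notin> set W" by (auto simp: O1_def O2_def nbrs_def)
    then have "cyc (W @ [u])"
      using W(1,2) lW E_V2 E_sym by (auto simp: cyc_def pth_append)
    from noW[OF this] show False by auto
  qed
  from cycle_lemma[OF W(1) lW] obtain C where C: "cyc C"
    "card (nbrs (hd W) \<inter> set W) + card (nbrs (last W) \<inter> set W) \<le> length C"
    using noW by blast
  have split: "deg v = card (nbrs v \<inter> set W) + card (nbrs v - set W)" for v
    unfolding deg_def using card_Int_Diff[OF fin_nbrs] by simp
  have "card O1 + card O2 + card (set W - X) \<le> card L"
  proof -
    have "card (O1 \<union> O2) = card O1 + card O2"
      using dis O LV finite_subset by (intro card_Un_disjoint) blast+
    moreover have "card ((O1 \<union> O2) \<union> (set W - X)) = card (O1 \<union> O2) + card (set W - X)"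
      by (intro card_Un_disjoint) (auto simp: O1_def O2_def fin_nbrs)
    moreover have "card ((O1 \<union> O2) \<union> (set W - X)) \<le> card L"
      using O LV W(1) by (intro card_mono) (auto simp: L_def pth_def)
    ultimately show ?thesis by linarith
  qed
  \<comment> \<open>With l low vertices on \<open>W\<close>, the cycle lemma gives 2(c - t) <= (c -
    1) + (\<open>card L\<close> - l). Since l is at least
    \<open>deg (hd p) + deg (last p) - 2\<close>, it follows that c plus these two degrees is at
    most \<open>card L + 2 * t + 1\<close>, contrary to \<open>ineq\<close>.\<close>
  moreover have "c \<le> deg (hd W) + t" "c \<le> deg (last W) + t" using W(3,4) by (auto simp: X_def)
  moreover have "length C < c" by (rule nc[OF C(1)])
  ultimately show False
    using ineq Wlow C(2) split[of "hd W"] split[of "last W"] unfolding O1_def O2_def by linarith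
qed

end

section \<open>Graphs as symmetric digraphs\<close>

lemma rtrancl_on_imp_rtranclp:
  assumes "(u, w) \<in> rtrancl_on F r" "\<And>a b. (a, b) \<in> r \<Longrightarrow> a \<in> F \<Longrightarrow> b \<in> F \<Longrightarrow> R a b"
  shows "(\<lambda>a b. R a b \<and> a \<in> F \<and> b \<in> F)\<^sup>*\<^sup>* u w"
  using assms(1)
proof (induction rule: rtrancl_on_induct)
  case (step y z)
  then show ?case using assms(2) by (auto intro: rtranclp.rtrancl_into_rtrancl)
qed simp

context graph
begin

lemma out_degree_conv: "out_degree G v = card {u. v \<rightarrow>\<^bsub>G\<^esub> u}"
proof -
  have "inj_on (head G) (out_arcs G v)"
    by (rule inj_onI) (auto intro!: no_multi_arcs simp: arc_to_ends_def)
  moreover have "head G ` out_arcs G v = {u. v \<rightarrow>\<^bsub>G\<^esub> u}"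
    by (auto simp: arcs_ends_conv image_iff)
  ultimately show ?thesis unfolding out_degree_def by (metis card_image)
qed

text \<open>The library's connectedness refers to the symmetric closure, which for a symmetric
  digraph has the same reachability. Deleting \<open>z\<close> is harmless when \<open>z\<close> is
  not a vertex, and otherwise is covered by the absence of cut-vertices.\<close>

lemma two_conn_dominates:
  assumes "two_connected G"
  shows "two_conn (verts G) (dominates G)"
proof -
  have sym: "symmetric G" by (rule sym_arcs)
  have reach: "u \<rightarrow>\<^sup>*\<^bsub>G\<^esub> w" if "u \<in> verts G" "w \<in> verts G" for u w
  proof -
    have "strongly_connected (mk_symmetric G)"
      using assms by (simp add: two_connected_def connected_def)
    then have "u \<rightarrow>\<^sup>*\<^bsub>mk_symmetric G\<^esub> w" using that by (simp add: strongly_connected_def)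
    then show ?thesis by (simp only: reachable_mk_symmetric_eq[OF sym])
  qed
  show ?thesis
  proof
    show "finite (verts G)" by simp
    show "v \<rightarrow>\<^bsub>G\<^esub> u" if "u \<rightarrow>\<^bsub>G\<^esub> v" for u v
      using that sym by (simp add: arcs_ends_symmetric)
    show "\<not> u \<rightarrow>\<^bsub>G\<^esub> u" for u using adj_not_same by blast
    show "u \<in> verts G" if "u \<rightarrow>\<^bsub>G\<^esub> v" for u v using that by (auto elim: adj_in_verts)
    show "3 \<le> card (verts G)" using assms by (simp add: two_connected_def)
    show "(\<lambda>a b. a \<rightarrow>\<^bsub>G\<^esub> b \<and> a \<in> verts G \<and> b \<in> verts G)\<^sup>*\<^sup>* u w"
      if "u \<in> verts G" "w \<in> verts G" for u w
      using reach[OF that] unfolding reachable_def by (rule rtrancl_on_imp_rtranclp)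
    show "(\<lambda>a b. a \<rightarrow>\<^bsub>G\<^esub> b \<and> a \<in> verts G - {z} \<and> b \<in> verts G - {z})\<^sup>*\<^sup>* u w"
      if uw: "u \<in> verts G - {z}" "w \<in> verts G - {z}" for u w z
    proof (cases "z \<in> verts G")
      case True
      have "\<not> cut_vertex G z" using assms by (simp add: two_connected_def)
      then have "u \<rightarrow>\<^sup>*\<^bsub>pre_digraph.del_vert G z\<^esub> w"
        using uw reach True unfolding cut_vertex_def by blast
      then have "(u, w) \<in> rtrancl_on (verts G - {z}) (arcs_ends (pre_digraph.del_vert G z))"
        by (simp add: reachable_def verts_del_vert)
      then show ?thesis
        by (rule rtrancl_on_imp_rtranclp) (auto simp: arcs_ends_def ends_del_vert arcs_del_vert)
    next
      case False
      then have "verts G - {z} = verts G" by blast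
      moreover have "(\<lambda>a b. a \<rightarrow>\<^bsub>G\<^esub> b \<and> a \<in> verts G \<and> b \<in> verts G)\<^sup>*\<^sup>* u w"
        using reach[of u w] uw unfolding reachable_def by (intro rtrancl_on_imp_rtranclp) auto
      ultimately show ?thesis by simp
    qed
  qed
qed

lemma awalk_of_vertices:
  assumes "successively (dominates G) (u # xs)" "u \<in> verts G"
  shows "\<exists>p. awalk u p (last (u # xs)) \<and> awalk_verts u p = u # xs"
  using assms
proof (induction xs arbitrary: u)
  case Nil
  then show ?case by (intro exI[of _ "[]"]) (simp add: awalk_Nil_iff)
next
  case (Cons v xs)
  then obtain e where e: "e \<in> arcs G" "tail G e = u" "head G e = v" by auto
  then have "v \<in> verts G" by auto
  with Cons obtain p where "awalk v p (last (v # xs))" "awalk_verts v p = v # xs" by auto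
  then show ?case
    using e by (intro exI[of _ "e # p"]) (auto simp: awalk_Cons_iff)
qed

lemma graph_cycle_of_vertices:
  assumes "distinct C" "successively (dominates G) C" "3 \<le> length C" "last C \<rightarrow>\<^bsub>G\<^esub> hd C"
  obtains p where "graph_cycle G p" "length p = length C"
proof -
  obtain u xs where C: "C = u # xs" using assms(3) by (cases C) auto
  have "u \<in> verts G" using assms(4) C by auto
  moreover have "successively (dominates G) (u # (xs @ [u]))"
    using assms(2,4) C by (cases xs) (auto simp: successively_append_iff successively_Cons hd_append)
  ultimately obtain p where p: "awalk u p u" "awalk_verts u p = u # xs @ [u]"
    using awalk_of_vertices[of u "xs @ [u]"] by auto
  have len: "length p = length C"
    using arg_cong[OF p(2), of length] C by (simp add: length_awalk_verts)
  have "cycle p" unfolding cycle_def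
    using p assms(1) C len by (intro exI[of _ u]) auto
  then show thesis using that[of p] len assms(3) by (simp add: graph_cycle_def)
qed

text \<open>A supremum of naturals is an upper bound only for a bounded set. The bound is the number
  of vertices, as the vertices of a cycle after its first entry are distinct.\<close>

lemma length_graph_cycle_le_circumference:
  assumes "graph_cycle G p"
  shows "length p \<le> circumference G"
proof -
  have "length q \<le> card (verts G)" if gq: "graph_cycle G q" for q
  proof -
    obtain u where u: "awalk u q u" "distinct (tl (awalk_verts u q))"
      using gq by (auto simp: graph_cycle_def cycle_def)
    have "set (tl (awalk_verts u q)) \<subseteq> verts G"
      using u(1) by (meson awalkE list.set_sel(2) subset_iff awalk_verts_non_Nil)
    then have "card (set (tl (awalk_verts u q))) \<le> card (verts G)" by (intro card_mono) auto
    then show ?thesis using distinct_card[OF u(2)] by (simp add: length_awalk_verts)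
  qed
  then have "bdd_above {length q |q. graph_cycle G q}" by (intro bdd_aboveI) auto
  then show ?thesis
    unfolding circumference_def by (rule cSup_upper[rotated]) (use assms in blast)
qed

end

theorem theorem2p2:
  fixes G :: "('a, 'b) pre_digraph" and x :: "nat \<Rightarrow> 'a" and n c :: nat
  assumes "graph G"
    and "two_connected G"
    and "card (verts G) = n"
    and "bij_betw x {1..n} (verts G)"
    and "0 < c" and "c \<le> n"
    and "\<And>i j. 1 \<le> i \<Longrightarrow> i < j \<Longrightarrow> j \<le> n \<Longrightarrow>
           i + j < c \<or>
           x i \<rightarrow>\<^bsub>G\<^esub> x j \<or>
           vdegree G (x i) > i \<or>
           vdegree G (x j) \<ge> j \<or>
           vdegree G (x i) + vdegree G (x j) \<ge> c"
    and "n \<ge> 3 * c - 1"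
  shows "circumference G \<ge> c"
proof -
  interpret graph G by (rule assms(1))
  interpret two_conn "verts G" "dominates G" by (rule two_conn_dominates[OF assms(2)])
  \<comment> \<open>The enumeration \<open>x\<close> is inverted, as \<open>long_cycle\<close> works
    with an index function on vertices.\<close>
  define f where "f = the_inv_into {1..n} x"
  have inj: "inj_on x {1..n}" and img: "x ` {1..n} = verts G"
    using assms(4) by (auto simp: bij_betw_def)
  have f: "inj_on f (verts G)" "f ` verts G = {1..n}"
    using bij_betw_the_inv_into[OF assms(4)] by (auto simp: bij_betw_def f_def)
  have xf: "x (f v) = v" if "v \<in> verts G" for v
    using that inj img by (auto simp: f_def intro: f_the_inv_into_f)
  have d: "vdegree G v = deg v" for v by (simp add: out_degree_conv deg_def nbrs_def)
  have "\<exists>C. cyc C \<and> c \<le> length C"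
  proof (rule long_cycle[OF f assms(3) _ assms(6)])
    show "2 * c \<le> n + 1" using assms(5,8) by linarith
    show "f u + f v < c \<or> u \<rightarrow>\<^bsub>G\<^esub> v \<or> f u < deg u \<or> f v \<le> deg v \<or> c \<le> deg u + deg v"
      if "u \<in> verts G" "v \<in> verts G" "f u < f v" for u v
    proof -
      have "1 \<le> f u" "f v \<le> n" using f(2) that by auto
      from assms(7)[OF this(1) that(3) this(2)] show ?thesis using that xf d by simp
    qed
  qed
  then obtain C where "cyc C" "c \<le> length C" by blast
  moreover from this obtain p where "graph_cycle G p" "length p = length C"
    using graph_cycle_of_vertices[of C] by (auto simp: cyc_def pth_def)
  ultimately show ?thesis using length_graph_cycle_le_circumference[of p] by simp
qed

end
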